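(* There exists an absolute constant $c'>0$ such that for all $t\ge 1$, $$\varphi_H(t)\ge c'\,t\log(\mathrm{e}+t).$$ In particular, if $\psi:[1,\infty)\to[0,\infty)$ is increasing and $\lim_{t\to\infty}\frac{\psi(t)}{t\log(\mathrm e+t)}=0$, then the inequality $\|Hf\|_{L^{1,\infty}(w)}\le \psi([w]_{A_1})\|f\|_{L^1(w)}$ cannot hold for all weights $w$ with $[w]_{A_1}<\infty$ and all $f\in L^1(w)$.
   Context: A weight is a non-negative locally integrable function on $\mathbb R$; $w(E)=\int_E w$. The Hardy–Littlewood maximal operator is $Mf(x)=\sup_{I\ni x}\frac1{|I|}\int_I|f|$, the supremum over all intervals $I\subset\mathbb R$ containing $x$. The Hilbert transform is $Hf(x)=\mathrm{P.V.}\int_{\mathbb R}\frac{f(y)}{x-y}\,dy$. For a weight $w$, $[w]_{A_1}=\|Mw/w\|_{L^\infty}$. The weak norm is $\|g\|_{L^{1,\infty}(w)}=\sup_{\alpha>0}\alpha\, w\{x:|g(x)|>\alpha\}$. For $t\ge1$, $\varphi_H(t)=\sup_{[w]_{A_1}\le t}\|H\|_{L^1(w)\to L^{1,\infty}(w)}$. *)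

theory Defs
  imports "HOL-Analysis.Analysis"
begin

definition is_weight :: "(real \<Rightarrow> real) \<Rightarrow> bool" where
  "is_weight w \<longleftrightarrow> w \<in> borel_measurable borel \<and> (\<forall>x. 0 \<le> w x) \<and>
     (\<forall>a b. set_integrable lborel {a..b} w)"

definition wmeasure :: "(real \<Rightarrow> real) \<Rightarrow> real measure" where
  "wmeasure w = density lborel (\<lambda>x. ennreal (w x))"

definition maximal_fn :: "(real \<Rightarrow> real) \<Rightarrow> real \<Rightarrow> ennreal" where
  "maximal_fn f x = (SUP I \<in> {{a..b} | a b. a < b \<and> a \<le> x \<and> x \<le> b}.
      (\<integral>\<^sup>+ y. ennreal (\<bar>f y\<bar>) * indicator I y \<partial>lborel) / ennreal (measure lborel I))"

definition A1_const :: "(real \<Rightarrow> real) \<Rightarrow> ennreal" where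
  "A1_const w = Inf {C. AE x in lborel. maximal_fn w x / ennreal (w x) \<le> C}"

definition hilbert :: "(real \<Rightarrow> real) \<Rightarrow> real \<Rightarrow> real" where
  "hilbert f x = Lim (at_right 0)
     (\<lambda>\<epsilon>. LINT y|lborel. indicator {y. \<epsilon> < \<bar>x - y\<bar>} y * (f y / (x - y)))"

definition L1w :: "(real \<Rightarrow> real) \<Rightarrow> (real \<Rightarrow> real) set" where
  "L1w w = {f. f \<in> borel_measurable borel \<and> (\<integral>\<^sup>+ x. ennreal (\<bar>f x\<bar> * w x) \<partial>lborel) < \<infinity>}"

definition L1w_norm :: "(real \<Rightarrow> real) \<Rightarrow> (real \<Rightarrow> real) \<Rightarrow> ennreal" where
  "L1w_norm w f = (\<integral>\<^sup>+ x. ennreal (\<bar>f x\<bar> * w x) \<partial>lborel)"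

definition weakL1w_norm :: "(real \<Rightarrow> real) \<Rightarrow> (real \<Rightarrow> real) \<Rightarrow> ennreal" where
  "weakL1w_norm w g = (SUP \<alpha> \<in> {0<..}. ennreal \<alpha> * emeasure (wmeasure w) {x. \<alpha> < \<bar>g x\<bar>})"

definition hilbert_opnorm :: "(real \<Rightarrow> real) \<Rightarrow> ennreal" where
  "hilbert_opnorm w = (SUP f \<in> {f \<in> L1w w. L1w_norm w f \<noteq> 0}.
      weakL1w_norm w (hilbert f) / L1w_norm w f)"

definition phi_H :: "real \<Rightarrow> ennreal" where
  "phi_H t = (SUP w \<in> {w. is_weight w \<and> A1_const w \<le> ennreal t}. hilbert_opnorm w)"

end

(*
  Inside an interval K of length l (density of the weight D), keep the weight at level D/m except
  on a block of length l/64, which is split into m children carrying the same structure with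
  density 64 D; after m generations the weight on the remaining core is constant. Each K also
  carries a charge, the indicator of an interval of one child's length just left of the block.
  The weight is A1 with constant O(m), since next to the low plateau D/m the density never exceeds
  O(D) in the mean, while the weighted mass of the charge is only 1/(64 m).

  On the d-th child, the Hilbert transform of the charge of K is at least 1/(d+2), which averages
  to about (log m)/m over the children. The charges of the siblings contribute at most
  (log m)/(7 m) in absolute value: packing the children into 1/64 of K makes their charges that
  much weaker than the one next to the block. Since the choices of children in successive
  generations are independent, a bound for the exponential moment shows that the sum over the m
  generations exceeds c log m on at least half of the core. So the weak-type norm is at least
  c' m log m.
*)

theory Submission
  imports Defs "HOL-Real_Asymp.Real_Asymp"
begin

section \<open>Hilbert transforms of step functions\<close>

definition trunc_hilbert :: "(real \<Rightarrow> real) \<Rightarrow> real \<Rightarrow> real \<Rightarrow> real" where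
  "trunc_hilbert f x \<epsilon> = (LINT y|lborel. indicator {y. \<epsilon> < \<bar>x - y\<bar>} y * (f y / (x - y)))"

text \<open>\<open>hilbert\<close> is a \<open>Lim\<close>, which says nothing where no limit
  exists, so genuine convergence is recorded instead. A finite exceptional set suffices because the
  transform of a step function is singular only at the jumps. Integrability of \<open>f\<close>
  makes the truncated integrals additive.\<close>

definition has_hilbert :: "(real \<Rightarrow> real) \<Rightarrow> (real \<Rightarrow> real) \<Rightarrow> bool" where
  "has_hilbert f g \<longleftrightarrow> integrable lborel f \<and> g \<in> borel_measurable borel \<and>
     (\<exists>Z. finite Z \<and> (\<forall>x. x \<notin> Z \<longrightarrow> (trunc_hilbert f x \<longlongrightarrow> g x) (at_right 0)))"

lemma integrable_trunc:
  fixes f :: "real \<Rightarrow> real"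
  assumes f: "integrable lborel f" and e: "0 < \<epsilon>"
  shows "integrable lborel (\<lambda>y. indicator {y. \<epsilon> < \<bar>x - y\<bar>} y * (f y / (x - y)))"
proof (rule Bochner_Integration.integrable_bound[of _ "\<lambda>y. f y / \<epsilon>"])
  have [measurable]: "f \<in> borel_measurable borel"
    using f by auto
  show "(\<lambda>y. indicator {y. \<epsilon> < \<bar>x - y\<bar>} y * (f y / (x - y))) \<in> borel_measurable lborel"
    by measurable
  show "AE y in lborel. norm (indicator {y. \<epsilon> < \<bar>x - y\<bar>} y * (f y / (x - y))) \<le> norm (f y / \<epsilon>)"
    using e by (auto simp: indicator_def abs_mult intro!: AE_I2 divide_left_mono mult_pos_pos)
qed (use f in simp)

lemma has_hilbert_add:
  assumes "has_hilbert f g" "has_hilbert f' g'"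
  shows "has_hilbert (\<lambda>x. f x + f' x) (\<lambda>x. g x + g' x)"
proof -
  obtain Z Z' where Z: "finite Z" "\<And>x. x \<notin> Z \<Longrightarrow> (trunc_hilbert f x \<longlongrightarrow> g x) (at_right 0)"
    and Z': "finite Z'" "\<And>x. x \<notin> Z' \<Longrightarrow> (trunc_hilbert f' x \<longlongrightarrow> g' x) (at_right 0)"
    using assms unfolding has_hilbert_def by blast
  have i: "integrable lborel f" "integrable lborel f'"
    and [measurable]: "g \<in> borel_measurable borel" "g' \<in> borel_measurable borel"
    using assms unfolding has_hilbert_def by auto
  have "(trunc_hilbert (\<lambda>x. f x + f' x) x \<longlongrightarrow> g x + g' x) (at_right 0)" if "x \<notin> Z \<union> Z'" for x
  proof (rule Lim_transform_eventually)
    show "((\<lambda>\<epsilon>. trunc_hilbert f x \<epsilon> + trunc_hilbert f' x \<epsilon>) \<longlongrightarrow> g x + g' x) (at_right 0)"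
      using that by (intro tendsto_add Z Z') auto
    show "\<forall>\<^sub>F \<epsilon> in at_right 0. trunc_hilbert f x \<epsilon> + trunc_hilbert f' x \<epsilon>
        = trunc_hilbert (\<lambda>x. f x + f' x) x \<epsilon>"
      unfolding eventually_at_right_field trunc_hilbert_def
      using integrable_trunc[OF i(1)] integrable_trunc[OF i(2)]
      by (auto simp flip: Bochner_Integration.integral_add simp: add_divide_distrib distrib_left
               intro!: exI[of _ 1])
  qed
  then show ?thesis
    unfolding has_hilbert_def using i Z(1) Z'(1)
    by (auto intro!: exI[of _ "Z \<union> Z'"])
qed

lemma has_hilbert_zero: "has_hilbert (\<lambda>_. 0) (\<lambda>_. 0)"
  unfolding has_hilbert_def trunc_hilbert_def by auto

lemma has_hilbert_sum:
  assumes "\<And>i. i \<in> A \<Longrightarrow> has_hilbert (f i) (g i)"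
  shows "has_hilbert (\<lambda>x. \<Sum>i\<in>A. f i x) (\<lambda>x. \<Sum>i\<in>A. g i x)"
  using assms
  by (induction A rule: infinite_finite_induct) (auto intro: has_hilbert_zero has_hilbert_add)

text \<open>An antiderivative of 1 / (x - y) in y is - ln |x - y|. With \<open>x\<close> outside
  \<open>{p..q}\<close> the sign of x - y is constant, so the absolute value can be resolved on
  either side.\<close>

lemma has_bochner_integral_kernel:
  fixes p q x :: real
  assumes "p \<le> q" "x < p \<or> q < x"
  shows "has_bochner_integral lborel (\<lambda>y. 1 / (x - y) * indicator {p..q} y)
           (ln (\<bar>x - p\<bar>) - ln (\<bar>x - q\<bar>))"
proof -
  have "has_bochner_integral lborel (\<lambda>y. 1 / (x - y) * indicator {p..q} y)
           ((- ln (\<bar>x - q\<bar>)) - (- ln (\<bar>x - p\<bar>)))"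
  proof (rule has_bochner_integral_FTC_Icc_real[where F = "\<lambda>y. - ln (\<bar>x - y\<bar>)"])
    fix y assume y: "p \<le> y" "y \<le> q"
    show "isCont (\<lambda>y. 1 / (x - y)) y"
      using y assms by (intro continuous_intros) auto
    from assms(2) show "((\<lambda>y. - ln (\<bar>x - y\<bar>)) has_real_derivative 1 / (x - y)) (at y)"
    proof
      assume "x < p"
      have "((\<lambda>y. - ln (y - x)) has_real_derivative 1 / (x - y)) (at y)"
        using \<open>x < p\<close> y by (auto intro!: derivative_eq_intros simp: field_simps)
      moreover have "\<forall>\<^sub>F z in nhds y. - ln (\<bar>x - z\<bar>) = - ln (z - x)"
        using eventually_nhds_in_open[of "{x<..}" y] \<open>x < p\<close> y by (auto elim: eventually_mono)
      ultimately show ?thesis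
        by (subst DERIV_cong_ev[OF refl _ refl, where g = "\<lambda>y. - ln (y - x)"]) auto
    next
      assume "q < x"
      have "((\<lambda>y. - ln (x - y)) has_real_derivative 1 / (x - y)) (at y)"
        using \<open>q < x\<close> y by (auto intro!: derivative_eq_intros simp: field_simps)
      moreover have "\<forall>\<^sub>F z in nhds y. - ln (\<bar>x - z\<bar>) = - ln (x - z)"
        using eventually_nhds_in_open[of "{..<x}" y] \<open>q < x\<close> y by (auto elim: eventually_mono)
      ultimately show ?thesis
        by (subst DERIV_cong_ev[OF refl _ refl, where g = "\<lambda>y. - ln (x - y)"]) auto
    qed
  qed (use assms in auto)
  then show ?thesis
    by simp
qed

text \<open>For small \<epsilon> the truncated integral no longer depends on \<epsilon>: if
  \<open>x\<close> is outside, truncation removes nothing; if \<open>x\<close> is inside, the two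
  remaining pieces contribute - ln \<epsilon> and + ln \<epsilon>, which cancel.\<close>

lemma has_hilbert_interval:
  fixes a b :: real
  assumes ab: "a < b"
  shows "has_hilbert (indicator {a..<b}) (\<lambda>x. ln (\<bar>x - a\<bar>) - ln (\<bar>x - b\<bar>))"
proof -
  have ev: "\<forall>\<^sub>F \<epsilon> in at_right 0. trunc_hilbert (indicator {a..<b}) x \<epsilon> = ln (\<bar>x - a\<bar>) - ln (\<bar>x - b\<bar>)"
    if x: "x \<noteq> a" "x \<noteq> b" for x
  proof (cases "x < a \<or> b < x")
    case True
    have "trunc_hilbert (indicator {a..<b}) x \<epsilon> = ln (\<bar>x - a\<bar>) - ln (\<bar>x - b\<bar>)"
      if "0 < \<epsilon>" "\<epsilon> < min \<bar>x - a\<bar> \<bar>x - b\<bar>" for \<epsilon>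
    proof -
      have "trunc_hilbert (indicator {a..<b}) x \<epsilon> = (LINT y|lborel. 1 / (x - y) * indicator {a..b} y)"
        unfolding trunc_hilbert_def
      proof (rule integral_cong_AE)
        show "AE y in lborel. indicator {y. \<epsilon> < \<bar>x - y\<bar>} y * (indicator {a..<b} y / (x - y))
              = 1 / (x - y) * indicator {a..b} y"
          using AE_lborel_singleton[of b]
          by eventually_elim (use True that in \<open>auto simp: indicator_def\<close>)
      qed measurable
      then show ?thesis
        using has_bochner_integral_integral_eq[OF has_bochner_integral_kernel[of a b x]] True ab
        by simp
    qed
    then show ?thesis
      unfolding eventually_at_right_field using x
      by (intro exI[of _ "min \<bar>x - a\<bar> \<bar>x - b\<bar>"]) auto
  next
    case False
    then have x': "a < x" "x < b"
      using x by auto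
    have "trunc_hilbert (indicator {a..<b}) x \<epsilon> = ln (\<bar>x - a\<bar>) - ln (\<bar>x - b\<bar>)"
      if e: "0 < \<epsilon>" "\<epsilon> < min \<bar>x - a\<bar> \<bar>x - b\<bar>" for \<epsilon>
    proof -
      have "trunc_hilbert (indicator {a..<b}) x \<epsilon>
          = (LINT y|lborel. 1 / (x - y) * indicator {a..x-\<epsilon>} y + 1 / (x - y) * indicator {x+\<epsilon>..b} y)"
        unfolding trunc_hilbert_def
      proof (rule integral_cong_AE)
        show "AE y in lborel. indicator {y. \<epsilon> < \<bar>x - y\<bar>} y * (indicator {a..<b} y / (x - y))
              = 1 / (x - y) * indicator {a..x-\<epsilon>} y + 1 / (x - y) * indicator {x+\<epsilon>..b} y"
          using AE_lborel_singleton[of b] AE_lborel_singleton[of "x - \<epsilon>"] AE_lborel_singleton[of "x + \<epsilon>"]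
          by eventually_elim (use x' that in \<open>auto simp: indicator_def\<close>)
      qed measurable
      also have "\<dots> = (ln (\<bar>x - a\<bar>) - ln (\<bar>x - (x - \<epsilon>)\<bar>)) + (ln (\<bar>x - (x + \<epsilon>)\<bar>) - ln (\<bar>x - b\<bar>))"
        by (rule has_bochner_integral_integral_eq[OF has_bochner_integral_add
              [OF has_bochner_integral_kernel has_bochner_integral_kernel]]) (use x' e in auto)
      finally show ?thesis
        by simp
    qed
    then show ?thesis
      unfolding eventually_at_right_field using x
      by (intro exI[of _ "min \<bar>x - a\<bar> \<bar>x - b\<bar>"]) auto
  qed
  show ?thesis
    unfolding has_hilbert_def
    using ev ab by (auto intro!: exI[of _ "{a, b}"] tendsto_eventually)
qed

text \<open>Outside the finite set \<open>Lim\<close> agrees with the limit. Measurability is what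
  allows the weighted measure of the level sets of \<open>hilbert f\<close> to be computed as an
  integral.\<close>

lemma has_hilbert_AE:
  assumes "has_hilbert f g"
  shows "AE x in lborel. hilbert f x = g x"
    and "hilbert f \<in> borel_measurable borel"
proof -
  obtain Z where Z: "finite Z" "\<And>x. x \<notin> Z \<Longrightarrow> (trunc_hilbert f x \<longlongrightarrow> g x) (at_right 0)"
    and [measurable]: "g \<in> borel_measurable borel"
    using assms unfolding has_hilbert_def by blast
  have eq: "hilbert f x = g x" if "x \<notin> Z" for x
    using tendsto_Lim[OF _ Z(2)[OF that]] unfolding hilbert_def trunc_hilbert_def by simp
  have "Z \<in> null_sets lborel"
    using Z(1) by (simp add: finite_imp_null_set_lborel)
  then show "AE x in lborel. hilbert f x = g x"
    by (rule AE_I') (use eq in auto)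
  show "hilbert f \<in> borel_measurable borel"
    by (rule measurable_discrete_difference[of g _ _ Z])
       (use eq Z(1) in \<open>auto intro: countable_finite\<close>)
qed

section \<open>The branching construction\<close>

text \<open>\<open>m\<close> is the number of children of an interval and, in the final choice, also
  the number of generations.\<close>

locale branching =
  fixes m :: nat
  assumes m_pos: "0 < m"
begin

definition sub :: "real \<Rightarrow> real" where
  "sub l = l / (64 * real m)"

text \<open>The children tile the block from c + l / 4 to c + l / 4 + l / 64. Its distance of at
  least l / 4 from both ends separates core points from sibling intervals and controls averages over
  intervals that enter from outside.\<close>

definition pos :: "real \<Rightarrow> real \<Rightarrow> nat \<Rightarrow> real" where
  "pos c l d = c + l / 4 + real d * sub l"

primrec charge :: "nat \<Rightarrow> real \<Rightarrow> real \<Rightarrow> real \<Rightarrow> real" where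
  "charge 0 = (\<lambda>c l x. 0)"
| "charge (Suc n) = (\<lambda>c l x. indicator {c + l / 4 - sub l..<c + l / 4} x
     + (\<Sum>d<m. charge n (pos c l d) (sub l) x))"

text \<open>The Hilbert transform of \<open>charge\<close> in closed form, one logarithm difference
  per charge; see \<open>has_hilbert_charge\<close>.\<close>

primrec potential :: "nat \<Rightarrow> real \<Rightarrow> real \<Rightarrow> real \<Rightarrow> real" where
  "potential 0 = (\<lambda>c l x. 0)"
| "potential (Suc n) = (\<lambda>c l x. (ln (\<bar>x - (c + l / 4 - sub l)\<bar>) - ln (\<bar>x - (c + l / 4)\<bar>))
     + (\<Sum>d<m. potential n (pos c l d) (sub l) x))"

text \<open>The factor 64 compensates for the block filling only 1/64 of the interval: density times
  length, summed over the children, is again D * l.\<close>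

primrec weight :: "nat \<Rightarrow> real \<Rightarrow> real \<Rightarrow> real \<Rightarrow> real \<Rightarrow> real" where
  "weight 0 = (\<lambda>D c l x. D * indicator {c..<c + l} x)"
| "weight (Suc n) = (\<lambda>D c l x.
     D / real m * indicator ({c..<c + l / 4} \<union> {c + l / 4 + l / 64..<c + l}) x
     + (\<Sum>d<m. weight n (64 * D) (pos c l d) (sub l) x))"

text \<open>Open intervals at the last generation keep core points off the left end of every block,
  which is the right end of a charge and a singularity of the potential.\<close>

primrec core :: "nat \<Rightarrow> real \<Rightarrow> real \<Rightarrow> real \<Rightarrow> real \<Rightarrow> real" where
  "core 0 = (\<lambda>D c l x. D * indicator {c<..<c + l} x)"
| "core (Suc n) = (\<lambda>D c l x. \<Sum>d<m. core n (64 * D) (pos c l d) (sub l) x)"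

section \<open>Geometry of the children, supports and self-similarity\<close>

lemma sub_pos [simp]: "0 < l \<Longrightarrow> 0 < sub l"
  using m_pos by (simp add: sub_def)

lemma m_mult_sub: "real m * sub l = l / 64"
  using m_pos by (simp add: sub_def)

lemma sub_le: "0 < l \<Longrightarrow> sub l \<le> l / 64"
  using m_pos by (simp add: sub_def field_simps)

lemma pos_add_sub: "pos c l d + sub l = pos c l (Suc d)"
  by (simp add: pos_def algebra_simps)

lemma pos_0 [simp]: "pos c l 0 = c + l / 4"
  by (simp add: pos_def)

lemma pos_m: "pos c l m = c + l / 4 + l / 64"
  by (simp add: pos_def m_mult_sub)

lemma pos_mono: "0 < l \<Longrightarrow> d \<le> d' \<Longrightarrow> pos c l d \<le> pos c l d'"
  by (simp add: pos_def mult_right_mono less_imp_le)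

lemma child_bounds:
  assumes "0 < l" "d < m"
  shows "c + l / 4 \<le> pos c l d" "pos c l d + sub l \<le> c + l / 4 + l / 64"
  using pos_mono[of l 0 d c] pos_mono[of l "Suc d" m c] assms by (auto simp: pos_add_sub pos_m)

lemma children_disjoint:
  assumes "0 < l" "x \<in> {pos c l d..<pos c l d + sub l}" "x \<in> {pos c l d'..<pos c l d' + sub l}"
  shows "d = d'"
proof (rule ccontr)
  assume "d \<noteq> d'"
  then show False
    using assms pos_mono[of l "Suc d" d' c] pos_mono[of l "Suc d'" d c]
    by (cases "d < d'") (auto simp: pos_add_sub)
qed

lemma children_cover:
  assumes "0 < l" "x \<in> {c + l / 4..<c + l / 4 + l / 64}"
  obtains d where "d < m" "x \<in> {pos c l d..<pos c l d + sub l}"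
proof -
  have "\<exists>d<k. x \<in> {pos c l d..<pos c l d + sub l}" if "x < pos c l k" for k
    using that
  proof (induction k)
    case 0
    then show ?case
      using assms by simp
  next
    case (Suc k)
    then show ?case
      by (cases "x < pos c l k") (auto simp: pos_add_sub less_Suc_eq)
  qed
  from this[of m] show ?thesis
    using that assms by (auto simp: pos_m)
qed

lemma charge_nonneg: "0 \<le> charge n c l x"
  by (induction n arbitrary: c l) (auto intro!: add_nonneg_nonneg sum_nonneg)

lemma weight_nonneg: "0 \<le> D \<Longrightarrow> 0 \<le> weight n D c l x"
  by (induction n arbitrary: D c l) (auto intro!: add_nonneg_nonneg sum_nonneg)

lemma core_nonneg: "0 \<le> D \<Longrightarrow> 0 \<le> core n D c l x"
  by (induction n arbitrary: D c l) (auto intro!: sum_nonneg)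

lemma core_le_weight: "0 \<le> D \<Longrightarrow> core n D c l x \<le> weight n D c l x"
  by (induction n arbitrary: D c l) (auto intro!: add_increasing sum_mono simp: indicator_def)

lemma measurable_charge [measurable]: "charge n c l \<in> borel_measurable borel"
  by (induction n arbitrary: c l) auto

lemma measurable_potential [measurable]: "potential n c l \<in> borel_measurable borel"
  by (induction n arbitrary: c l) auto

lemma measurable_weight [measurable]: "weight n D c l \<in> borel_measurable borel"
  by (induction n arbitrary: D c l) auto

lemma measurable_core [measurable]: "core n D c l \<in> borel_measurable borel"
  by (induction n arbitrary: D c l) auto

lemma has_hilbert_charge: "0 < l \<Longrightarrow> has_hilbert (charge n c l) (potential n c l)"
proof (induction n arbitrary: c l)
  case 0
  then show ?case
    by (simp add: has_hilbert_zero)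
next
  case (Suc n)
  then show ?case
    using sub_pos[of l]
    by (auto intro!: has_hilbert_add has_hilbert_sum has_hilbert_interval simp del: sub_pos)
qed

lemma weight_eq_0:
  "0 < l \<Longrightarrow> x \<notin> {c..<c + l} \<Longrightarrow> weight n D c l x = 0"
proof (induction n arbitrary: D c l)
  case (Suc n)
  have "weight n (64 * D) (pos c l d) (sub l) x = 0" if "d < m" for d
    using Suc.prems child_bounds[OF Suc.prems(1) that, of c] by (intro Suc.IH) auto
  then show ?case
    using Suc.prems by (auto simp: indicator_def)
qed auto

lemma charge_eq_0:
  "0 < l \<Longrightarrow> x \<notin> {c..<c + l} \<Longrightarrow> charge n c l x = 0"
proof (induction n arbitrary: c l)
  case (Suc n)
  have "charge n (pos c l d) (sub l) x = 0" if "d < m" for d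
    using Suc.prems child_bounds[OF Suc.prems(1) that, of c] by (intro Suc.IH) auto
  then show ?case
    using Suc.prems sub_le[of l] by (auto simp: indicator_def)
qed auto

lemma core_eq_0:
  "0 < l \<Longrightarrow> x \<notin> {c<..<c + l} \<Longrightarrow> core n D c l x = 0"
proof (induction n arbitrary: D c l)
  case (Suc n)
  have "core n (64 * D) (pos c l d) (sub l) x = 0" if "d < m" for d
    using Suc.prems child_bounds[OF Suc.prems(1) that, of c] by (intro Suc.IH) auto
  then show ?case
    by simp
qed auto

text \<open>If a further generation follows, core points lie in the middle block. This gives the
  separation from siblings needed in \<open>potential_lower\<close>.\<close>

lemma core_Suc_eq_0:
  assumes "0 < l" "x \<notin> {c + l / 4..<c + l / 4 + l / 64}"
  shows "core (Suc n) D c l x = 0"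
proof -
  have "core n (64 * D) (pos c l d) (sub l) x = 0" if "d < m" for d
    using assms child_bounds[OF assms(1) that, of c] by (intro core_eq_0) auto
  then show ?thesis
    by simp
qed

lemma weight_outer:
  assumes "0 < l" "x \<in> {c..<c + l / 4} \<union> {c + l / 4 + l / 64..<c + l}"
  shows "weight (Suc n) D c l x = D / real m" 
proof -
  have "weight n (64 * D) (pos c l d) (sub l) x = 0" if "d < m" for d
    using assms child_bounds[OF assms(1) that, of c] by (intro weight_eq_0) auto
  then show ?thesis
    using assms by simp
qed

lemma sum_single:
  fixes g :: "nat \<Rightarrow> real"
  assumes "d < m" "\<And>d'. d' < m \<Longrightarrow> d' \<noteq> d \<Longrightarrow> g d' = 0"
  shows "(\<Sum>d'<m. g d') = g d"
proof -
  have "(\<Sum>d'<m. g d') = (\<Sum>d'\<in>{d}. g d')"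
    using assms by (intro sum.mono_neutral_right) auto
  then show ?thesis
    by simp
qed

lemma weight_child:
  assumes "0 < l" "d < m" "x \<in> {pos c l d..<pos c l d + sub l}"
  shows "weight (Suc n) D c l x = weight n (64 * D) (pos c l d) (sub l) x"
proof -
  have "weight n (64 * D) (pos c l d') (sub l) x = 0" if "d' < m" "d' \<noteq> d" for d'
    using assms that children_disjoint[OF assms(1)] by (intro weight_eq_0) (simp, blast)
  then show ?thesis
    using assms child_bounds[OF assms(1,2), of c] by (simp add: sum_single[of d])
qed

lemma charge_child:
  assumes "0 < l" "d < m" "x \<in> {pos c l d..<pos c l d + sub l}"
  shows "charge (Suc n) c l x = charge n (pos c l d) (sub l) x"
proof -
  have "charge n (pos c l d') (sub l) x = 0" if "d' < m" "d' \<noteq> d" for d'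
    using assms that children_disjoint[OF assms(1)] by (intro charge_eq_0) (simp, blast)
  then show ?thesis
    using assms child_bounds[OF assms(1,2), of c] by (simp add: sum_single[of d])
qed

text \<open>The outermost plateau is the lowest: each descent to a child replaces D by 64 *
  D.\<close>

lemma weight_lower:
  assumes "0 < l" "0 \<le> D" "x \<in> {c..<c + l}"
  shows "D / real m \<le> weight n D c l x"
  using assms
proof (induction n arbitrary: D c l)
  case 0
  then show ?case
    using m_pos mult_left_mono[of 1 "real m" D] by (simp add: field_simps)
next
  case (Suc n)
  show ?case
  proof (cases "x \<in> {c + l / 4..<c + l / 4 + l / 64}")
    case True
    then obtain d where d: "d < m" "x \<in> {pos c l d..<pos c l d + sub l}"
      using children_cover Suc.prems(1) by blast
    have "D / real m \<le> 64 * D / real m"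
      using Suc.prems by (simp add: divide_right_mono)
    also have "\<dots> \<le> weight (Suc n) D c l x"
      unfolding weight_child[OF Suc.prems(1) d] using Suc.prems d by (intro Suc.IH) auto
    finally show ?thesis .
  next
    case False
    then have "x \<in> {c..<c + l / 4} \<union> {c + l / 4 + l / 64..<c + l}"
      using Suc.prems by auto
    then show ?thesis
      using weight_outer Suc.prems(1) by (metis order_refl)
  qed
qed

section \<open>Masses and the lower bound for the potential\<close>

lemma sum_const_ennreal: "0 \<le> k \<Longrightarrow> (\<Sum>d<n. ennreal k) = ennreal (real n * k)"
  by (subst sum_ennreal) auto

text \<open>The mass passes unchanged from one generation to the next, since 64 * m *
  \<open>sub l\<close> = l.\<close>

lemma nn_integral_core:
  assumes "0 < l" "0 \<le> D"
  shows "(\<integral>\<^sup>+x. ennreal (core n D c l x) \<partial>lborel) = ennreal (D * l)"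
  using assms
proof (induction n arbitrary: D c l)
  case 0
  then show ?case
    by (simp add: ennreal_mult' nn_integral_cmult ennreal_indicator)
next
  case (Suc n)
  have "(\<integral>\<^sup>+x. ennreal (core (Suc n) D c l x) \<partial>lborel)
      = (\<Sum>d<m. \<integral>\<^sup>+x. ennreal (core n (64 * D) (pos c l d) (sub l) x) \<partial>lborel)"
    using Suc.prems core_nonneg[of "64 * D"] by (simp add: nn_integral_sum flip: sum_ennreal)
  also have "\<dots> = (\<Sum>d<m. ennreal (64 * D * sub l))"
    using Suc by simp
  also have "\<dots> = ennreal (D * l)"
    using Suc.prems m_pos by (subst sum_const_ennreal) (auto simp: less_imp_le sub_def)
  finally show ?case .
qed

text \<open>Each generation adds plateaus of total mass at most D * l / m, while the children carry
  D * l as before. For n \<le> m this keeps the mass below 2 * D * l.\<close>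

lemma nn_integral_weight:
  assumes "0 < l" "0 \<le> D"
  shows "(\<integral>\<^sup>+x. ennreal (weight n D c l x) \<partial>lborel) \<le> ennreal (D * l * (1 + real n / real m))"
  using assms
proof (induction n arbitrary: D c l)
  case 0
  then show ?case
    by (simp add: ennreal_mult' nn_integral_cmult ennreal_indicator)
next
  case (Suc n)
  let ?O = "{c..<c + l / 4} \<union> {c + l / 4 + l / 64..<c + l}"
  have "(\<integral>\<^sup>+x. ennreal (weight (Suc n) D c l x) \<partial>lborel)
      = (\<integral>\<^sup>+x. ennreal (D / real m) * indicator ?O x
           + (\<Sum>d<m. ennreal (weight n (64 * D) (pos c l d) (sub l) x)) \<partial>lborel)"
    using Suc.prems weight_nonneg[of "64 * D"]
    by (simp add: sum_nonneg ennreal_mult' ennreal_indicator del: times_divide_eq_left)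
  also have "\<dots> = ennreal (D / real m) * emeasure lborel ?O
       + (\<Sum>d<m. \<integral>\<^sup>+x. ennreal (weight n (64 * D) (pos c l d) (sub l) x) \<partial>lborel)"
    by (simp add: nn_integral_add nn_integral_sum nn_integral_cmult)
  also have "\<dots> \<le> ennreal (D / real m) * emeasure lborel {c..<c + l}
       + (\<Sum>d<m. ennreal (64 * D * sub l * (1 + real n / real m)))"
    using Suc by (intro add_mono mult_left_mono emeasure_mono sum_mono) auto
  also have "\<dots> = ennreal (D / real m * l + real m * (64 * D * sub l * (1 + real n / real m)))"
    using Suc.prems by (subst sum_const_ennreal)
      (auto simp: less_imp_le simp flip: ennreal_plus ennreal_mult')
  also have "D / real m * l + real m * (64 * D * sub l * (1 + real n / real m))
      = D * l * (1 + real (Suc n) / real m)"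
    using m_pos by (simp add: sub_def field_simps)
  finally show ?case .
qed

text \<open>The charge of the outer interval has length l / (64 * m) and lies on the plateau of
  height D / m. Every generation contributes the same amount, because D * l summed over its
  intervals is constant.\<close>

lemma nn_integral_charge_weight:
  assumes "0 < l" "0 \<le> D"
  shows "(\<integral>\<^sup>+x. ennreal (charge n c l x * weight n D c l x) \<partial>lborel)
       = ennreal (D * l * real n / (64 * (real m)\<^sup>2))"
  using assms
proof (induction n arbitrary: D c l)
  case (Suc n)
  let ?I = "{c + l / 4 - sub l..<c + l / 4}"
  have nn: "0 \<le> charge n (pos c l d) (sub l) x * weight n (64 * D) (pos c l d) (sub l) x" for d x
    using charge_nonneg weight_nonneg Suc.prems by simp
  \<comment> \<open>No cross terms arise in the product: the outer charge lies on the plateau, where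
    all children vanish, and distinct children have disjoint supports.\<close>
  have eq: "charge (Suc n) c l x * weight (Suc n) D c l x
      = D / real m * indicator ?I x
        + (\<Sum>d<m. charge n (pos c l d) (sub l) x * weight n (64 * D) (pos c l d) (sub l) x)" for x
  proof (cases "x \<in> {c + l / 4..<c + l / 4 + l / 64}")
    case True
    then obtain d where d: "d < m" "x \<in> {pos c l d..<pos c l d + sub l}"
      using children_cover Suc.prems(1) by blast
    have "weight n (64 * D) (pos c l d') (sub l) x = 0" if "d' < m" "d' \<noteq> d" for d'
      using Suc.prems d that children_disjoint[OF Suc.prems(1)]
      by (intro weight_eq_0) (simp, blast)
    then have "(\<Sum>d<m. charge n (pos c l d) (sub l) x * weight n (64 * D) (pos c l d) (sub l) x)
        = charge n (pos c l d) (sub l) x * weight n (64 * D) (pos c l d) (sub l) x"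
      using d by (intro sum_single) auto
    then show ?thesis
      unfolding weight_child[OF Suc.prems(1) d] charge_child[OF Suc.prems(1) d]
      using True by simp
  next
    case False
    have z: "weight n (64 * D) (pos c l d) (sub l) x = 0" "charge n (pos c l d) (sub l) x = 0"
      if "d < m" for d
      using False Suc.prems child_bounds[OF Suc.prems(1) that, of c]
      by (auto intro!: weight_eq_0 charge_eq_0)
    then have "(\<Sum>d<m. weight n (64 * D) (pos c l d) (sub l) x) = 0"
      "(\<Sum>d<m. charge n (pos c l d) (sub l) x) = 0"
      by auto
    then show ?thesis
      using z sub_le[OF Suc.prems(1)] Suc.prems(1) by (auto simp: indicator_def)
  qed
  have "(\<integral>\<^sup>+x. ennreal (charge (Suc n) c l x * weight (Suc n) D c l x) \<partial>lborel)
      = (\<integral>\<^sup>+x. ennreal (D / real m) * indicator ?I x + (\<Sum>d<m. ennreal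
          (charge n (pos c l d) (sub l) x * weight n (64 * D) (pos c l d) (sub l) x)) \<partial>lborel)"
    unfolding eq using Suc.prems nn
    by (simp add: sum_nonneg ennreal_mult' ennreal_indicator del: times_divide_eq_left)
  also have "\<dots> = ennreal (D / real m) * emeasure lborel ?I + (\<Sum>d<m. \<integral>\<^sup>+x. ennreal
          (charge n (pos c l d) (sub l) x * weight n (64 * D) (pos c l d) (sub l) x) \<partial>lborel)"
    by (simp add: nn_integral_add nn_integral_sum nn_integral_cmult)
  also have "\<dots> = ennreal (D / real m) * ennreal (sub l)
      + (\<Sum>d<m. ennreal (64 * D * sub l * real n / (64 * (real m)\<^sup>2)))"
    using Suc by (simp add: less_imp_le)
  also have "\<dots> = ennreal (D / real m * sub l + real m * (64 * D * sub l * real n / (64 * (real m)\<^sup>2)))"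
    using Suc.prems by (subst sum_const_ennreal)
      (auto simp: less_imp_le simp flip: ennreal_plus ennreal_mult')
  also have "D / real m * sub l + real m * (64 * D * sub l * real n / (64 * (real m)\<^sup>2))
      = D * l * real (Suc n) / (64 * (real m)\<^sup>2)"
    using m_pos by (simp add: sub_def field_simps power2_eq_square)
  finally show ?case .
qed simp

section \<open>Pointwise lower bound for the potential on a child\<close>

lemma abs_ln_diff_le:
  fixes u v r :: real
  assumes "0 < r" "r \<le> u" "r \<le> v"
  shows "\<bar>ln u - ln v\<bar> \<le> \<bar>u - v\<bar> / r"
proof -
  have *: "ln u - ln v \<le> \<bar>u - v\<bar> / r" if "r \<le> u" "r \<le> v" for u v :: real
  proof -
    have "ln u - ln v = ln (u / v)"
      using assms that by (simp add: ln_div)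
    also have "\<dots> \<le> u / v - 1"
      using assms that by (intro ln_le_minus_one) auto
    also have "\<dots> = (u - v) / v"
      using assms that by (simp add: field_simps)
    also have "\<dots> \<le> \<bar>u - v\<bar> / v"
      using assms that by (intro divide_right_mono) auto
    also have "\<dots> \<le> \<bar>u - v\<bar> / r"
      using assms that by (intro divide_left_mono) auto
    finally show ?thesis .
  qed
  show ?thesis
    using *[of u v] *[of v u] assms by (simp add: abs_minus_commute)
qed

text \<open>The factor \<open>l / (63 m)\<close> bounds the total charge: it is the sum of
  \<open>l / (64 m)\<close> over the generations, each of which covers \<open>1 / 64\<close> of the previous one.\<close>

lemma abs_potential_far_le:
  assumes "0 < l" "0 < r" "x \<le> c - r \<or> c + l + r \<le> x"
  shows "\<bar>potential n c l x\<bar> \<le> l / (63 * real m * r)"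
  using assms
proof (induction n arbitrary: c l)
  case (Suc n)
  have "\<bar>ln (\<bar>x - (c + l / 4 - sub l)\<bar>) - ln (\<bar>x - (c + l / 4)\<bar>)\<bar>
      \<le> \<bar>\<bar>x - (c + l / 4 - sub l)\<bar> - \<bar>x - (c + l / 4)\<bar>\<bar> / r"
    using Suc.prems sub_le[of l] sub_pos[of l] by (intro abs_ln_diff_le) linarith+
  also have "\<dots> \<le> sub l / r"
    using Suc.prems(2) sub_pos[OF Suc.prems(1)]
      abs_triangle_ineq3[of "x - (c + l / 4 - sub l)" "x - (c + l / 4)"]
    by (intro divide_right_mono) auto
  finally have 1: "\<bar>ln (\<bar>x - (c + l / 4 - sub l)\<bar>) - ln (\<bar>x - (c + l / 4)\<bar>)\<bar> \<le> sub l / r" .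
  have "\<bar>\<Sum>d<m. potential n (pos c l d) (sub l) x\<bar> \<le> (\<Sum>d<m. sub l / (63 * real m * r))"
  proof (intro order_trans[OF sum_abs] sum_mono)
    fix d assume "d \<in> {..<m}"
    then show "\<bar>potential n (pos c l d) (sub l) x\<bar> \<le> sub l / (63 * real m * r)"
      using Suc.prems child_bounds[of l d c] by (intro Suc.IH) auto
  qed
  also have "\<dots> = sub l / (63 * r)"
    using m_pos by simp
  finally have 2: "\<bar>\<Sum>d<m. potential n (pos c l d) (sub l) x\<bar> \<le> sub l / (63 * r)" .
  \<comment> \<open>The constant 63 reproduces itself: 1/64 + 1/(64 * 63) = 1/63.\<close>
  have "sub l / r + sub l / (63 * r) = l / (63 * real m * r)"
    using m_pos Suc.prems by (simp add: sub_def field_simps)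
  then show ?case
    using 1 2 by simp
qed auto

text \<open>At most one index on each side has a given distance from \<open>d\<close>, so each side
  is bounded by a harmonic sum.\<close>

lemma sum_inverse_dist_le:
  assumes "d < m"
  shows "(\<Sum>d'\<in>{..<m} - {d}. 1 / \<bar>real d - real d'\<bar>) \<le> 2 * harm m"
proof -
  have "(\<Sum>d'\<in>{..<m} - {d}. 1 / \<bar>real d - real d'\<bar>)
      = (\<Sum>d'\<in>{..<d} \<union> {d<..<m}. 1 / \<bar>real d - real d'\<bar>)"
    using assms by (intro sum.cong) auto
  also have "\<dots> = (\<Sum>d'\<in>{..<d}. 1 / \<bar>real d - real d'\<bar>) + (\<Sum>d'\<in>{d<..<m}. 1 / \<bar>real d - real d'\<bar>)"
    by (intro sum.union_disjoint) auto
  also have "(\<Sum>d'\<in>{..<d}. 1 / \<bar>real d - real d'\<bar>) = (\<Sum>k\<in>{1..d}. inverse (real k))"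
  proof (rule sum.reindex_bij_witness[of _ "\<lambda>k. d - k" "\<lambda>k. d - k"])
    fix k assume "k \<in> {..<d}"
    then have "real (d - k) = \<bar>real d - real k\<bar>"
      by auto
    then show "inverse (real (d - k)) = 1 / \<bar>real d - real k\<bar>"
      by (simp only: inverse_eq_divide)
  qed auto
  also have "\<dots> \<le> (\<Sum>k\<in>{1..m}. inverse (real k))"
    using assms by (intro sum_mono2) auto
  also have "(\<Sum>d'\<in>{d<..<m}. 1 / \<bar>real d - real d'\<bar>) = (\<Sum>k\<in>{1..<m - d}. inverse (real k))"
  proof (rule sum.reindex_bij_witness[of _ "\<lambda>k. d + k" "\<lambda>k. k - d"])
    fix k assume "k \<in> {d<..<m}"
    then have "real (k - d) = \<bar>real d - real k\<bar>"
      by auto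
    then show "inverse (real (k - d)) = 1 / \<bar>real d - real k\<bar>"
      by (simp only: inverse_eq_divide)
  qed auto
  also have "\<dots> \<le> (\<Sum>k\<in>{1..m}. inverse (real k))"
    by (intro sum_mono2) auto
  finally show ?thesis
    by (simp add: harm_def)
qed

text \<open>The own charge gives - ln (1 - u) \<ge> u, where u is the length of the charge over the
  distance from \<open>x\<close> to its left end. The siblings are treated as far charges, at
  distances growing linearly with the index difference, which costs a harmonic sum.\<close>

lemma potential_lower:
  assumes l: "0 < l" and d: "d < m"
    and nz: "core n (64 * D) (pos c l d) (sub l) x \<noteq> 0"
  shows "potential n (pos c l d) (sub l) x + 1 / (real d + 2) - harm m / (7 * real m)
    \<le> potential (Suc n) c l x"
proof -
  let ?s = "sub l" and ?p = "pos c l d"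
  have s: "0 < ?s"
    using l by simp
  have x: "x \<in> {?p<..<?p + ?s}"
    using core_eq_0[of ?s x ?p] nz s by blast
  have xa: "0 < x - (c + l / 4 - ?s)" and xb: "0 < x - (c + l / 4)"
    using x child_bounds[OF l d, of c] s by auto
  \<comment> \<open>Besides the \<open>d\<close> children before it, \<open>x\<close> is separated
    from the left end of the charge by the charge itself and by at most its own child: hence d +
    2.\<close>
  have xd: "x - (c + l / 4 - ?s) \<le> (real d + 2) * ?s"
    using x by (simp add: pos_def algebra_simps)
  have "1 / (real d + 2) = ?s / ((real d + 2) * ?s)"
    using s by simp
  also have "\<dots> \<le> ?s / (x - (c + l / 4 - ?s))"
    using xd s xa by (intro divide_left_mono) auto
  also have "\<dots> \<le> ln (\<bar>x - (c + l / 4 - ?s)\<bar>) - ln (\<bar>x - (c + l / 4)\<bar>)"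
  proof -
    have "ln ((x - (c + l / 4)) / (x - (c + l / 4 - ?s)))
        \<le> (x - (c + l / 4)) / (x - (c + l / 4 - ?s)) - 1"
      using xa xb by (intro ln_le_minus_one) auto
    also have "\<dots> = - (?s / (x - (c + l / 4 - ?s)))"
      using xa by (simp add: field_simps)
    finally show ?thesis
      using xa xb by (simp add: ln_div)
  qed
  finally have own: "1 / (real d + 2) \<le> ln (\<bar>x - (c + l / 4 - ?s)\<bar>) - ln (\<bar>x - (c + l / 4)\<bar>)" .
  have sib: "\<bar>potential n (pos c l d') ?s x\<bar> \<le> 4 / (63 * real m) * (1 / \<bar>real d - real d'\<bar>)"
    if d': "d' \<noteq> d" for d'
  proof (cases n)
    \<comment> \<open>Without further generations the siblings carry no charge.\<close>
    case 0
    then show ?thesis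
      by simp
  next
    case (Suc k)
    have x: "x \<in> {?p + ?s / 4..<?p + ?s / 4 + ?s / 64}"
      using core_Suc_eq_0[of ?s x ?p k "64 * D"] nz s Suc by auto
    \<comment> \<open>The factor 1/4 is dictated by the left neighbour: \<open>x\<close> is only
      known to lie a quarter of a child's length inside its own child.\<close>
    define r where "r = \<bar>real d - real d'\<bar> * (?s / 4)"
    have "0 < r"
      using d' s by (simp add: r_def)
    moreover have "x \<le> pos c l d' - r \<or> pos c l d' + ?s + r \<le> x"
    proof -
      have p: "pos c l d' = ?p + (real d' - real d) * ?s"
        by (simp add: pos_def algebra_simps)
      consider "1 \<le> real d' - real d" | "1 \<le> real d - real d'"
        using d' by linarith
      then show ?thesis
      proof cases
        case 1
        then have "1 * ?s \<le> (real d' - real d) * ?s"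
          using s by (intro mult_right_mono) auto
        moreover have "r = (real d' - real d) * ?s / 4"
          using \<open>1 \<le> real d' - real d\<close> by (simp add: r_def)
        ultimately show ?thesis
          using x s unfolding p atLeastLessThan_iff by linarith
      next
        case 2
        then have "1 * ?s \<le> (real d - real d') * ?s"
          using s by (intro mult_right_mono) auto
        moreover have "r = (real d - real d') * ?s / 4"
          using \<open>1 \<le> real d - real d'\<close> by (simp add: r_def)
        moreover have "(real d' - real d) * ?s = - ((real d - real d') * ?s)"
          by (simp add: algebra_simps)
        ultimately show ?thesis
          using x s unfolding p atLeastLessThan_iff by linarith
      qed
    qed
    ultimately have "\<bar>potential n (pos c l d') ?s x\<bar> \<le> ?s / (63 * real m * r)"
      using abs_potential_far_le s by blast
    also have "\<dots> = 4 / (63 * real m) * (1 / \<bar>real d - real d'\<bar>)"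
      using s by (simp add: r_def)
    finally show ?thesis .
  qed
  have "\<bar>\<Sum>d'\<in>{..<m} - {d}. potential n (pos c l d') ?s x\<bar>
      \<le> (\<Sum>d'\<in>{..<m} - {d}. 4 / (63 * real m) * (1 / \<bar>real d - real d'\<bar>))"
    by (intro order_trans[OF sum_abs] sum_mono sib) auto
  also have "\<dots> \<le> 4 / (63 * real m) * (2 * harm m)"
    unfolding sum_distrib_left[symmetric]
    using sum_inverse_dist_le[OF d] by (intro mult_left_mono) auto
  \<comment> \<open>8/63 is below 9/63 = 1/7.\<close>
  also have "\<dots> \<le> harm m / (7 * real m)"
    using m_pos harm_nonneg[of m, where 'a = real] by (simp add: field_simps)
  finally have "\<bar>\<Sum>d'\<in>{..<m} - {d}. potential n (pos c l d') ?s x\<bar> \<le> harm m / (7 * real m)" .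
  moreover have "(\<Sum>d'<m. potential n (pos c l d') ?s x) = potential n ?p ?s x
      + (\<Sum>d'\<in>{..<m} - {d}. potential n (pos c l d') ?s x)"
    using d by (intro sum.remove) auto
  ultimately show ?thesis
    using own by simp
qed

section \<open>Exponential moment\<close>

lemma sum_inverse_eq_harm: "(\<Sum>d<n. 1 / (real d + 2)) = harm (Suc n) - 1"
  by (induction n) (simp_all add: harm_Suc harm_expand(1) inverse_eq_divide add_ac)

lemma exp_minus_le:
  fixes x :: real
  assumes "0 \<le> x" "x \<le> 1"
  shows "exp (- x) \<le> 1 - x / 2"
proof -
  have "exp (- x) \<le> 1 / (1 + x)"
    using exp_ge_add_one_self[of x] assms by (simp add: exp_minus inverse_eq_divide frac_le)
  also have "\<dots> \<le> 1 - x / 2"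
  proof -
    have "x * x \<le> x * 1"
      using assms by (intro mult_left_mono) auto
    then show ?thesis
      using assms by (simp add: field_simps)
  qed
  finally show ?thesis .
qed

text \<open>An average over the children of one generation: the mean gain is at least (harm m - 1) /
  m, half of it survives \<open>exp_minus_le\<close>, and the sibling loss harm m / (7 * m) is
  subtracted.\<close>

lemma sum_exp_le:
  assumes "7 \<le> (harm m :: real)"
  shows "(\<Sum>d<m. exp (harm m / (7 * real m) - 1 / (real d + 2)))
    \<le> real m * exp (- (2 * harm m / (7 * real m)))"
proof -
  let ?L = "harm m :: real"
  have "(\<Sum>d<m. exp (- (1 / (real d + 2)))) \<le> (\<Sum>d<m. 1 - (1 / (real d + 2)) / 2)"
    by (intro sum_mono exp_minus_le) auto
  also have "\<dots> = real m - (\<Sum>d<m. 1 / (real d + 2)) / 2"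
    by (simp add: sum_subtractf sum_divide_distrib)
  also have "\<dots> = real m - (harm (Suc m) - 1) / 2"
    by (simp only: sum_inverse_eq_harm)
  also have "\<dots> \<le> real m - (?L - 1) / 2"
    by (simp add: harm_Suc)
  also have "\<dots> = real m * (1 + - ((?L - 1) / (2 * real m)))"
    using m_pos by (simp add: field_simps)
  also have "\<dots> \<le> real m * exp (- ((?L - 1) / (2 * real m)))"
    by (intro mult_left_mono exp_ge_add_one_self) auto
  finally have "exp (?L / (7 * real m)) * (\<Sum>d<m. exp (- (1 / (real d + 2))))
      \<le> exp (?L / (7 * real m)) * (real m * exp (- ((?L - 1) / (2 * real m))))"
    by (intro mult_left_mono) auto
  also have "\<dots> = real m * exp (?L / (7 * real m) + - ((?L - 1) / (2 * real m)))"
    unfolding exp_add by (simp only: mult_ac)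
  also have "\<dots> \<le> real m * exp (- (2 * ?L / (7 * real m)))"
  proof -
    \<comment> \<open>After clearing denominators this is exactly the condition 7 \<le>
      \<open>harm m\<close>.\<close>
    have "?L / (7 * real m) + - ((?L - 1) / (2 * real m)) \<le> - (2 * ?L / (7 * real m))"
      using assms m_pos by (simp add: field_simps)
    then show ?thesis
      by (intro mult_left_mono) auto
  qed
  finally show ?thesis
    by (simp only: sum_distrib_left exp_add[symmetric] diff_conv_add_uminus)
qed

text \<open>This replaces an independence argument. The gain in \<open>potential_lower\<close>
  depends only on the child index, so it factors out of the integral over that child, and summing
  over the children gains the factor of \<open>sum_exp_le\<close> in each generation.\<close>

lemma exponential_moment:
  assumes L: "7 \<le> (harm m :: real)" and "0 < l" "0 \<le> D"
  shows "(\<integral>\<^sup>+x. ennreal (core n D c l x * exp (- potential n c l x)) \<partial>lborel)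
    \<le> ennreal (D * l * exp (- (2 * harm m / (7 * real m))) ^ n)"
  using assms(2,3)
proof (induction n arbitrary: D c l)
  case 0
  then show ?case
    by (simp add: ennreal_mult' nn_integral_cmult ennreal_indicator)
next
  case (Suc n)
  let ?r = "exp (- (2 * harm m / (7 * real m))) :: real"
  let ?e = "\<lambda>d. exp (harm m / (7 * real m) - 1 / (real d + 2))"
  let ?g = "\<lambda>d x. core n (64 * D) (pos c l d) (sub l) x * exp (- potential n (pos c l d) (sub l) x)"
  have nn: "0 \<le> ?g d x" for d x
    using Suc.prems by (intro mult_nonneg_nonneg core_nonneg) auto
  have "core (Suc n) D c l x * exp (- potential (Suc n) c l x) \<le> (\<Sum>d<m. ?e d * ?g d x)" for x
  proof -
    have "core (Suc n) D c l x * exp (- potential (Suc n) c l x)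
        = (\<Sum>d<m. core n (64 * D) (pos c l d) (sub l) x * exp (- potential (Suc n) c l x))"
      by (simp add: sum_distrib_right)
    also have "\<dots> \<le> (\<Sum>d<m. ?e d * ?g d x)"
    proof (rule sum_mono)
      fix d assume d: "d \<in> {..<m}"
      show "core n (64 * D) (pos c l d) (sub l) x * exp (- potential (Suc n) c l x) \<le> ?e d * ?g d x"
      proof (cases "core n (64 * D) (pos c l d) (sub l) x = 0")
        case False
        have "exp (- potential (Suc n) c l x) \<le> exp ((harm m / (7 * real m) - 1 / (real d + 2))
            + - potential n (pos c l d) (sub l) x)"
          using potential_lower[OF Suc.prems(1) _ False] d by (simp del: potential.simps)
        then have "core n (64 * D) (pos c l d) (sub l) x * exp (- potential (Suc n) c l x)
            \<le> core n (64 * D) (pos c l d) (sub l) x *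
              (?e d * exp (- potential n (pos c l d) (sub l) x))"
          using Suc.prems unfolding exp_add by (intro mult_left_mono core_nonneg) auto
        then show ?thesis
          by (simp only: mult_ac)
      qed simp
    qed
    finally show ?thesis .
  qed
  then have "(\<integral>\<^sup>+x. ennreal (core (Suc n) D c l x * exp (- potential (Suc n) c l x)) \<partial>lborel)
      \<le> (\<integral>\<^sup>+x. ennreal (\<Sum>d<m. ?e d * ?g d x) \<partial>lborel)"
    by (intro nn_integral_mono ennreal_leI)
  also have "\<dots> = (\<integral>\<^sup>+x. (\<Sum>d<m. ennreal (?e d) * ennreal (?g d x)) \<partial>lborel)"
    using nn by (intro nn_integral_cong, subst sum_ennreal[symmetric]) (auto simp: ennreal_mult')
  also have "\<dots> = (\<Sum>d<m. ennreal (?e d) * (\<integral>\<^sup>+x. ennreal (?g d x) \<partial>lborel))"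
    by (subst nn_integral_sum) (auto simp: nn_integral_cmult)
  also have "\<dots> \<le> (\<Sum>d<m. ennreal (?e d) * ennreal (64 * D * sub l * ?r ^ n))"
    using Suc by (intro sum_mono mult_left_mono) auto
  also have "\<dots> = ennreal ((\<Sum>d<m. ?e d) * (64 * D * sub l * ?r ^ n))"
    using Suc.prems unfolding sum_distrib_right[symmetric]
    by (subst sum_ennreal) (auto simp: ennreal_mult'' less_imp_le)
  also have "\<dots> \<le> ennreal ((real m * ?r) * (64 * D * sub l * ?r ^ n))"
    using Suc.prems sum_exp_le[OF L] by (intro ennreal_leI mult_right_mono) (auto simp: less_imp_le)
  also have "(real m * ?r) * (64 * D * sub l * ?r ^ n) = D * l * ?r ^ Suc n"
    using m_mult_sub[of l] by (simp add: algebra_simps)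
  finally show ?case .
qed

text \<open>Markov's inequality for exp (- potential) after m generations: the core has mass 1, and
  the portion with potential at most harm m / 7 has mass at most exp (harm m / 7 - 2 * harm m / 7),
  which is at most exp (- 1) < 1/2.\<close>

lemma core_potential_large:
  assumes L: "7 \<le> (harm m :: real)"
  shows "ennreal (1 / 2) \<le> (\<integral>\<^sup>+x. ennreal (core m 1 0 1 x) * indicator {x. harm m / 7 < potential m 0 1 x} x \<partial>lborel)"
    (is "_ \<le> ?X")
proof -
  let ?L = "harm m :: real"
  let ?S = "{x. ?L / 7 < potential m 0 1 x}"
  have "ennreal 1 = (\<integral>\<^sup>+x. ennreal (core m 1 0 1 x) \<partial>lborel)"
    using nn_integral_core[of 1 1 m 0] by simp
  also have "\<dots> \<le> (\<integral>\<^sup>+x. ennreal (core m 1 0 1 x) * indicator ?S x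
      + ennreal (exp (?L / 7)) * ennreal (core m 1 0 1 x * exp (- potential m 0 1 x)) \<partial>lborel)"
  proof (rule nn_integral_mono)
    fix x
    show "ennreal (core m 1 0 1 x) \<le> ennreal (core m 1 0 1 x) * indicator ?S x
      + ennreal (exp (?L / 7)) * ennreal (core m 1 0 1 x * exp (- potential m 0 1 x))"
    proof (cases "x \<in> ?S")
      case False
      then have "1 \<le> exp (?L / 7 + - potential m 0 1 x)"
        by simp
      then have "core m 1 0 1 x * 1 \<le> core m 1 0 1 x * exp (?L / 7 + - potential m 0 1 x)"
        by (intro mult_left_mono core_nonneg) auto
      then have "core m 1 0 1 x \<le> exp (?L / 7) * (core m 1 0 1 x * exp (- potential m 0 1 x))"
        unfolding exp_add by (simp only: mult_ac mult_1_right)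
      then show ?thesis
        using False by (simp add: ennreal_leI flip: ennreal_mult')
    qed simp
  qed
  also have "\<dots> = ?X + ennreal (exp (?L / 7)) *
      (\<integral>\<^sup>+x. ennreal (core m 1 0 1 x * exp (- potential m 0 1 x)) \<partial>lborel)"
    by (subst nn_integral_add) (auto simp: nn_integral_cmult)
  also have "\<dots> \<le> ?X + ennreal (exp (?L / 7)) * ennreal (exp (- (2 * harm m / (7 * real m))) ^ m)"
    using exponential_moment[OF L, of 1 1 m 0] by (intro add_left_mono mult_left_mono) auto
  also have "ennreal (exp (?L / 7)) * ennreal (exp (- (2 * harm m / (7 * real m))) ^ m)
      = ennreal (exp (- (?L / 7)))"
    using m_pos by (simp flip: ennreal_mult' exp_of_nat_mult exp_add)
  also have "?X + ennreal (exp (- (?L / 7))) \<le> ?X + ennreal (1 / 2)"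
  proof -
    have "exp (- (?L / 7)) \<le> exp (- 1)"
      using L by simp
    also have "\<dots> \<le> 1 / (2::real)"
      using exp_minus_le[of 1] by simp
    finally show ?thesis
      by (intro add_left_mono ennreal_leI)
  qed
  finally have "ennreal 1 \<le> ennreal (1 / 2) + ?X"
    by (simp only: add.commute)
  moreover have "ennreal 1 = ennreal (1 / 2) + ennreal (1 / 2)"
    by (subst ennreal_plus[symmetric]) auto
  ultimately show ?thesis
    by (simp only: ennreal_add_left_cancel_le) auto
qed

section \<open>The A1 constant\<close>

text \<open>An interval reaching past an end of K either misses the block and sees only the plateau,
  or it contains a quarter of K. In the second case the whole mass of K, at most 2 * D * l = 8 * D *
  (l / 4), is affordable.\<close>

lemma nn_integral_weight_end:
  assumes "0 < l" "0 \<le> D" "n \<le> m" "p \<le> q" "p \<le> c \<or> c + l \<le> q"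
  shows "(\<integral>\<^sup>+x. ennreal (weight n D c l x) * indicator {p..q} x \<partial>lborel)
    \<le> ennreal (8 * D) * emeasure lborel ({p..q} \<inter> {c..<c + l})"
proof -
  let ?M = "{c + l / 4..<c + l / 4 + l / 64}"
  have small: ?thesis
    if "\<And>x. x \<in> {p..q} \<inter> {c..<c + l} \<Longrightarrow> weight n D c l x \<le> 8 * D"
  proof -
    have "(\<integral>\<^sup>+x. ennreal (weight n D c l x) * indicator {p..q} x \<partial>lborel)
      \<le> (\<integral>\<^sup>+x. ennreal (8 * D) * indicator ({p..q} \<inter> {c..<c + l}) x \<partial>lborel)"
    proof (rule nn_integral_mono)
      fix x
      show "ennreal (weight n D c l x) * indicator {p..q} x
          \<le> ennreal (8 * D) * indicator ({p..q} \<inter> {c..<c + l}) x"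
        using that[of x] weight_eq_0[OF assms(1), of x c n D]
        by (cases "x \<in> {c..<c + l}") (auto simp: indicator_def intro: ennreal_leI)
    qed
    then show ?thesis
      by (simp add: nn_integral_cmult)
  qed
  show ?thesis
  proof (cases n)
    case 0
    then show ?thesis
      using assms(2) by (intro small) auto
  next
    case (Suc k)
    show ?thesis
    proof (cases "{p..q} \<inter> ?M = {}")
      case True
      have "D / real m \<le> D / 1"
        using assms(2) m_pos by (intro divide_left_mono) auto
      moreover have "weight n D c l x = D / real m" if "x \<in> {p..q} \<inter> {c..<c + l}" for x
        unfolding Suc using True that by (intro weight_outer assms) auto
      ultimately show ?thesis
        using assms(2) by (intro small) auto
    next
      case False
      then obtain z where z: "z \<in> {p..q}" "z \<in> ?M"
        by blast
      have quarter: "ennreal (l / 4) \<le> emeasure lborel ({p..q} \<inter> {c..<c + l})"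
      proof (cases "p \<le> c")
        case True
        then have "emeasure lborel {c..<c + l / 4} \<le> emeasure lborel ({p..q} \<inter> {c..<c + l})"
          using z assms(1) by (intro emeasure_mono) auto
        then show ?thesis
          using assms(1) by simp
      next
        case False
        then have "emeasure lborel {c + l / 2..<c + l / 2 + l / 4} \<le> emeasure lborel ({p..q} \<inter> {c..<c + l})"
          using z assms(1,5) by (intro emeasure_mono) auto
        then show ?thesis
          using assms(1) by simp
      qed
      have "(\<integral>\<^sup>+x. ennreal (weight n D c l x) * indicator {p..q} x \<partial>lborel)
          \<le> (\<integral>\<^sup>+x. ennreal (weight n D c l x) \<partial>lborel)"
        by (intro nn_integral_mono) (auto simp: indicator_def)
      also have "\<dots> \<le> ennreal (D * l * (1 + real n / real m))"
        using assms by (intro nn_integral_weight) auto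
      also have "\<dots> \<le> ennreal (8 * D * (l / 4))"
      proof (rule ennreal_leI)
        have "real n / real m \<le> 1"
          using assms(3) m_pos by simp
        then have "D * l * (1 + real n / real m) \<le> D * l * 2"
          using assms(1,2) by (intro mult_left_mono) auto
        then show "D * l * (1 + real n / real m) \<le> 8 * D * (l / 4)"
          by simp
      qed
      also have "\<dots> = ennreal (8 * D) * ennreal (l / 4)"
        using assms(1,2) by (intro ennreal_mult) auto
      also have "\<dots> \<le> ennreal (8 * D) * emeasure lborel ({p..q} \<inter> {c..<c + l})"
        using quarter by (intro mult_left_mono) auto
      finally show ?thesis .
    qed
  qed
qed

text \<open>The induction descends to the smallest construction interval containing
  \<open>{p..q}\<close>. There the average is at most 513 * D, while the weight at \<open>x\<close>
  is at least D / m by \<open>weight_lower\<close>; this ratio is the source of the factor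
  m.\<close>

lemma nn_integral_weight_inside:
  assumes "0 < l" "0 \<le> D" "n \<le> m" "c \<le> p" "p < q" "q < c + l" "x \<in> {p..q}"
  shows "(\<integral>\<^sup>+y. ennreal (weight n D c l y) * indicator {p..q} y \<partial>lborel)
    \<le> ennreal (513 * real m * weight n D c l x * (q - p))"
  using assms
proof (induction n arbitrary: D c l)
  case 0
  have "(\<integral>\<^sup>+y. ennreal (weight 0 D c l y) * indicator {p..q} y \<partial>lborel)
      = (\<integral>\<^sup>+y. ennreal D * indicator {p..q} y \<partial>lborel)"
    using 0 by (intro nn_integral_cong) (auto simp: indicator_def)
  also have "\<dots> = ennreal (D * (q - p))"
    using 0 by (simp add: nn_integral_cmult ennreal_mult')
  also have "\<dots> \<le> ennreal (513 * real m * weight 0 D c l x * (q - p))"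
  proof (rule ennreal_leI)
    have "1 * (D * (q - p)) \<le> (513 * real m) * (D * (q - p))"
      using 0 m_pos by (intro mult_right_mono mult_nonneg_nonneg) auto
    then show "D * (q - p) \<le> 513 * real m * weight 0 D c l x * (q - p)"
      using 0 by (simp add: mult_ac)
  qed
  finally show ?case .
next
  case (Suc n)
  show ?case
  proof (cases "\<exists>d<m. pos c l d \<le> p \<and> q < pos c l d + sub l")
    case True
    then obtain d where d: "d < m" "pos c l d \<le> p" "q < pos c l d + sub l"
      by blast
    then have "weight (Suc n) D c l y = weight n (64 * D) (pos c l d) (sub l) y" if "y \<in> {p..q}" for y
      using that by (intro weight_child Suc.prems) auto
    moreover from this have "(\<integral>\<^sup>+y. ennreal (weight (Suc n) D c l y) * indicator {p..q} y \<partial>lborel)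
        = (\<integral>\<^sup>+y. ennreal (weight n (64 * D) (pos c l d) (sub l) y) * indicator {p..q} y \<partial>lborel)"
      by (intro nn_integral_cong) (auto simp: indicator_def simp del: weight.simps)
    ultimately show ?thesis
      using Suc.IH[of "sub l" "64 * D" "pos c l d"] Suc.prems d by (simp del: weight.simps)
  next
    case False
    \<comment> \<open>Since no child contains \<open>{p..q}\<close>, the end estimate applies to
      every child with its density 64 * D, giving 8 * 64 = 512; the plateau adds the last D.\<close>
    have ends: "p \<le> pos c l d \<or> pos c l d + sub l \<le> q" if "d < m" for d
      using False that by (meson linear not_less)
    let ?w = "\<lambda>d. weight n (64 * D) (pos c l d) (sub l)"
    let ?K = "\<lambda>d. {p..q} \<inter> {pos c l d..<pos c l d + sub l}"
    have "(\<integral>\<^sup>+y. ennreal (weight (Suc n) D c l y) * indicator {p..q} y \<partial>lborel)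
      \<le> (\<integral>\<^sup>+y. ennreal D * indicator {p..q} y
           + (\<Sum>d<m. ennreal (?w d y) * indicator {p..q} y) \<partial>lborel)"
    proof (rule nn_integral_mono)
      fix y
      have nn: "0 \<le> ?w d y" for d
        using Suc.prems by (intro weight_nonneg) auto
      have "D / real m * indicator ({c..<c + l / 4} \<union> {c + l / 4 + l / 64..<c + l}) y \<le> D / 1 * 1"
        using Suc.prems m_pos by (intro mult_mono divide_left_mono) auto
      then have "weight (Suc n) D c l y \<le> D + (\<Sum>d<m. ?w d y)"
        by simp
      then have "ennreal (weight (Suc n) D c l y) \<le> ennreal (D + (\<Sum>d<m. ?w d y))"
        by (rule ennreal_leI)
      also have "\<dots> = ennreal D + (\<Sum>d<m. ennreal (?w d y))"
        using nn Suc.prems by (simp add: sum_nonneg)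
      finally show "ennreal (weight (Suc n) D c l y) * indicator {p..q} y
        \<le> ennreal D * indicator {p..q} y + (\<Sum>d<m. ennreal (?w d y) * indicator {p..q} y)"
        by (auto simp: indicator_def)
    qed
    also have "\<dots> = ennreal D * emeasure lborel {p..q}
        + (\<Sum>d<m. \<integral>\<^sup>+y. ennreal (?w d y) * indicator {p..q} y \<partial>lborel)"
      by (subst nn_integral_add, measurable, subst nn_integral_sum)
        (auto simp: nn_integral_cmult simp del: emeasure_lborel_Icc_eq)
    also have "\<dots> \<le> ennreal D * emeasure lborel {p..q}
        + (\<Sum>d<m. ennreal (8 * (64 * D)) * emeasure lborel (?K d))"
      using Suc.prems ends by (intro add_left_mono sum_mono nn_integral_weight_end) auto
    also have "(\<Sum>d<m. ennreal (8 * (64 * D)) * emeasure lborel (?K d))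
        = ennreal (512 * D) * emeasure lborel (\<Union>d<m. ?K d)"
    proof -
      have "disjoint_family_on ?K {..<m}"
        using children_disjoint[OF Suc.prems(1)] unfolding disjoint_family_on_def by blast
      then have "(\<Sum>d<m. emeasure lborel (?K d)) = emeasure lborel (\<Union>d<m. ?K d)"
        by (intro sum_emeasure) auto
      then show ?thesis
        by (simp flip: sum_distrib_left)
    qed
    also have "\<dots> \<le> ennreal (512 * D) * emeasure lborel {p..q}"
      by (intro mult_left_mono emeasure_mono) auto
    also have "ennreal D * emeasure lborel {p..q} + ennreal (512 * D) * emeasure lborel {p..q}
        = ennreal (D * (q - p) + 512 * D * (q - p))"
      using Suc.prems by (subst ennreal_plus) (auto simp: ennreal_mult')
    also have "D * (q - p) + 512 * D * (q - p) = 513 * D * (q - p)"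
      by (simp add: algebra_simps)
    also have "\<dots> \<le> ennreal (513 * real m * weight (Suc n) D c l x * (q - p))"
    proof (rule ennreal_leI)
      have "D \<le> weight (Suc n) D c l x * real m"
        using weight_lower[of l D x c "Suc n"] Suc.prems m_pos
        by (simp add: pos_divide_le_eq del: weight.simps)
      then have "513 * D * (q - p) \<le> 513 * (weight (Suc n) D c l x * real m) * (q - p)"
        using Suc.prems by (intro mult_right_mono mult_left_mono) auto
      then show "513 * D * (q - p) \<le> 513 * real m * weight (Suc n) D c l x * (q - p)"
        by (simp only: mult_ac)
    qed
    finally show ?thesis
      by simp
  qed
qed

text \<open>The outermost plateau height 1 / m is continued to the whole line, so the weight is
  positive everywhere.\<close>

definition a1_weight :: "real \<Rightarrow> real" where
  "a1_weight x = weight m 1 0 1 x + 1 / real m * indicator (- {0..<1}) x"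

lemma measurable_a1_weight [measurable]: "a1_weight \<in> borel_measurable borel"
  unfolding a1_weight_def by measurable

lemma a1_weight_lower: "1 / real m \<le> a1_weight x"
  using weight_lower[of 1 1 x 0 m] weight_nonneg[of 1 m 0 1 x]
  by (cases "x \<in> {0..<1}") (auto simp: a1_weight_def)

lemma a1_weight_pos: "0 < a1_weight x"
  using a1_weight_lower[of x] m_pos by (meson divide_pos_pos less_le_trans of_nat_0_less_iff zero_less_one)

lemma a1_weight_outside: "x \<notin> {0..<1} \<Longrightarrow> a1_weight x = 1 / real m"
  using weight_eq_0[of 1 x 0 m 1] by (simp add: a1_weight_def)

lemma nn_integral_a1_weight:
  assumes "p < q" "x \<in> {p..q}"
  shows "(\<integral>\<^sup>+y. ennreal (a1_weight y) * indicator {p..q} y \<partial>lborel)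
    \<le> ennreal (513 * real m * a1_weight x * (q - p))"
proof (cases "0 \<le> p \<and> q < 1")
  case True
  then have "a1_weight y = weight m 1 0 1 y" if "y \<in> {p..q}" for y
    using that by (auto simp: a1_weight_def)
  moreover from this have "(\<integral>\<^sup>+y. ennreal (a1_weight y) * indicator {p..q} y \<partial>lborel)
      = (\<integral>\<^sup>+y. ennreal (weight m 1 0 1 y) * indicator {p..q} y \<partial>lborel)"
    by (intro nn_integral_cong) (auto simp: indicator_def)
  ultimately show ?thesis
    using nn_integral_weight_inside[of 1 1 m 0 p q x] assms True by simp
next
  \<comment> \<open>Now \<open>{p..q}\<close> reaches past an end of the unit interval. The end
    estimate gives 8, the outer constant at most 1, and 9 is below 513.\<close>
  case False
  have "(\<integral>\<^sup>+y. ennreal (a1_weight y) * indicator {p..q} y \<partial>lborel)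
      \<le> (\<integral>\<^sup>+y. ennreal (weight m 1 0 1 y) * indicator {p..q} y + ennreal 1 * indicator {p..q} y \<partial>lborel)"
  proof (rule nn_integral_mono)
    fix y :: real
    have "1 / real m * indicator (- {0..<1}) y \<le> 1 * (1::real)"
      using m_pos by (intro mult_mono) auto
    then have "ennreal (a1_weight y) \<le> ennreal (weight m 1 0 1 y + 1)"
      unfolding a1_weight_def by (intro ennreal_leI) auto
    then show "ennreal (a1_weight y) * indicator {p..q} y
        \<le> ennreal (weight m 1 0 1 y) * indicator {p..q} y + ennreal 1 * indicator {p..q} y"
      using weight_nonneg[of 1 m 0 1 y] by (auto simp: indicator_def)
  qed
  also have "\<dots> = (\<integral>\<^sup>+y. ennreal (weight m 1 0 1 y) * indicator {p..q} y \<partial>lborel)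
      + emeasure lborel {p..q}"
    by (subst nn_integral_add) auto
  also have "\<dots> \<le> ennreal (8 * 1) * emeasure lborel ({p..q} \<inter> {0..<0+1}) + emeasure lborel {p..q}"
    using False assms by (intro add_right_mono nn_integral_weight_end) auto
  also have "\<dots> \<le> ennreal (8 * 1) * emeasure lborel {p..q} + emeasure lborel {p..q}"
    by (intro add_right_mono mult_left_mono emeasure_mono) auto
  also have "\<dots> = ennreal (8 * 1 * (q - p) + (q - p))"
    using assms by (subst ennreal_plus) (auto simp: ennreal_mult' simp del: right_diff_distrib_numeral)
  also have "8 * 1 * (q - p) + (q - p) = 9 * (q - p)"
    by simp
  also have "\<dots> \<le> ennreal (513 * real m * a1_weight x * (q - p))"
  proof (rule ennreal_leI)
    have "1 \<le> real m * a1_weight x"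
      using a1_weight_lower[of x] m_pos by (simp add: field_simps)
    then have "9 * (q - p) \<le> (513 * (real m * a1_weight x)) * (q - p)"
      using assms by (intro mult_right_mono) auto
    then show "9 * (q - p) \<le> 513 * real m * a1_weight x * (q - p)"
      by (simp only: mult_ac)
  qed
  finally show ?thesis .
qed

lemma is_weight_a1_weight: "is_weight a1_weight"
  unfolding is_weight_def
proof (intro conjI allI)
  fix a b :: real
  show "set_integrable lborel {a..b} a1_weight"
  proof (cases "a < b")
    case True
    have "(\<integral>\<^sup>+y. ennreal (norm (indicator {a..b} y *\<^sub>R a1_weight y)) \<partial>lborel)
        = (\<integral>\<^sup>+y. ennreal (a1_weight y) * indicator {a..b} y \<partial>lborel)"
      by (intro nn_integral_cong) (auto simp: indicator_def abs_of_pos[OF a1_weight_pos])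
    \<comment> \<open>The bound on averages, taken at the point \<open>a\<close>, already yields
      local integrability.\<close>
    also have "\<dots> < \<infinity>"
      using nn_integral_a1_weight[OF True, of a] True by (auto simp: less_top[symmetric] top_unique)
    finally show ?thesis
      unfolding set_integrable_def by (intro integrableI_bounded) auto
  next
    case False
    have "AE y in lborel. y \<notin> {a..b}"
      using AE_lborel_singleton[of a] by eventually_elim (use False in auto)
    then have "AE y in lborel. indicator {a..b} y *\<^sub>R a1_weight y = 0"
      by eventually_elim auto
    then show ?thesis
      unfolding set_integrable_def by (subst integrable_cong_AE[of _ _ "\<lambda>_. 0"]) auto
  qed
qed (use a1_weight_pos in \<open>auto simp: less_imp_le\<close>)

lemma A1_const_le: "A1_const a1_weight \<le> ennreal (513 * real m)"
proof -
  have "maximal_fn a1_weight x \<le> ennreal (513 * real m) * ennreal (a1_weight x)" for x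
    unfolding maximal_fn_def
  proof (rule SUP_least)
    fix I assume "I \<in> {{a..b} | a b. a < b \<and> a \<le> x \<and> x \<le> b}"
    then obtain a b where I: "I = {a..b}" "a < b" "x \<in> {a..b}"
      by auto
    have "(\<integral>\<^sup>+ y. ennreal \<bar>a1_weight y\<bar> * indicator I y \<partial>lborel)
        \<le> ennreal (513 * real m * a1_weight x) * ennreal (b - a)"
      using nn_integral_a1_weight[OF I(2,3)] I(2)
      by (simp add: I(1) abs_of_pos[OF a1_weight_pos] flip: ennreal_mult'')
    then have "(\<integral>\<^sup>+ y. ennreal \<bar>a1_weight y\<bar> * indicator I y \<partial>lborel) / ennreal (b - a)
        \<le> ennreal (513 * real m * a1_weight x) * ennreal (b - a) / ennreal (b - a)"
      by (rule divide_right_mono_ennreal)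
    also have "\<dots> = ennreal (513 * real m) * ennreal (a1_weight x)"
      using I(2) a1_weight_pos[of x] by (simp add: ennreal_mult_divide_eq ennreal_mult less_imp_le)
    finally show "(\<integral>\<^sup>+ y. ennreal \<bar>a1_weight y\<bar> * indicator I y \<partial>lborel) / ennreal (measure lborel I)
        \<le> ennreal (513 * real m) * ennreal (a1_weight x)"
      using I by simp
  qed
  then have "maximal_fn a1_weight x / ennreal (a1_weight x) \<le> ennreal (513 * real m)" for x
    using a1_weight_pos[of x]
      divide_right_mono_ennreal[of _ "ennreal (513 * real m) * ennreal (a1_weight x)" "ennreal (a1_weight x)"]
    by (simp add: ennreal_mult_divide_eq)
  then show ?thesis
    unfolding A1_const_def by (intro Inf_lower) auto
qed

text \<open>Needed because \<open>\<psi>\<close> is controlled only on [1, \<infinity>). On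
  \<open>{2..3}\<close> the weight is constant, so there the maximal function is at least the
  weight; as this interval has positive measure, an almost everywhere bound must hold at one of its
  points.\<close>

lemma A1_const_ge: "1 \<le> A1_const a1_weight"
  unfolding A1_const_def
proof (rule Inf_greatest)
  fix C assume "C \<in> {C. AE x in lborel. maximal_fn a1_weight x / ennreal (a1_weight x) \<le> C}"
  then have ae: "AE x in lborel. maximal_fn a1_weight x / ennreal (a1_weight x) \<le> C"
    by simp
  have "\<exists>x\<in>{2..3::real}. maximal_fn a1_weight x / ennreal (a1_weight x) \<le> C"
  proof (rule ccontr)
    assume "\<not> ?thesis"
    then have "AE x in lborel. x \<notin> {2..3::real}"
      using ae by (auto elim: eventually_mono)
    then have "{2..3::real} \<in> null_sets lborel"
      by (subst AE_iff_null_sets) auto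
    then have "emeasure lborel {2..3::real} = 0"
      by (rule null_setsD1)
    then show False
      by simp
  qed
  then obtain x :: real where x: "x \<in> {2..3}" "maximal_fn a1_weight x / ennreal (a1_weight x) \<le> C"
    by blast
  have "ennreal (a1_weight x) = (\<integral>\<^sup>+ y. ennreal (1 / real m) * indicator {2..3::real} y \<partial>lborel)"
    using a1_weight_outside[of x] x by (simp add: nn_integral_cmult)
  also have "\<dots> = (\<integral>\<^sup>+ y. ennreal \<bar>a1_weight y\<bar> * indicator {2..3} y \<partial>lborel) / ennreal (measure lborel {2..3::real})"
  proof -
    have "a1_weight y = 1 / real m" if "y \<in> {2..3}" for y :: real
      using that by (intro a1_weight_outside) auto
    then have "(\<integral>\<^sup>+ y. ennreal (1 / real m) * indicator {2..3::real} y \<partial>lborel)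
        = (\<integral>\<^sup>+ y. ennreal \<bar>a1_weight y\<bar> * indicator {2..3} y \<partial>lborel)"
      by (intro nn_integral_cong) (auto simp: indicator_def)
    then show ?thesis
      by (simp add: divide_ennreal_def)
  qed
  also have "\<dots> \<le> maximal_fn a1_weight x"
    unfolding maximal_fn_def by (rule SUP_upper) (use x in auto)
  finally have "ennreal (a1_weight x) / ennreal (a1_weight x) \<le> maximal_fn a1_weight x / ennreal (a1_weight x)"
    by (rule divide_right_mono_ennreal)
  then show "1 \<le> C"
    using x(2) a1_weight_pos[of x] by (simp add: ennreal_divide_self)
qed

section \<open>Weak-type norms\<close>

text \<open>The charges vanish outside the unit interval, so only the inner weight counts. The value
  is nonzero, which makes the charge admissible in \<open>hilbert_opnorm\<close>.\<close>

lemma L1w_norm_charge: "L1w_norm a1_weight (charge m 0 1) = ennreal (1 / (64 * real m))"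
proof -
  have "L1w_norm a1_weight (charge m 0 1)
      = (\<integral>\<^sup>+x. ennreal (charge m 0 1 x * weight m 1 0 1 x) \<partial>lborel)"
    unfolding L1w_norm_def
  proof (rule nn_integral_cong)
    fix x :: real
    show "ennreal (\<bar>charge m 0 1 x\<bar> * a1_weight x) = ennreal (charge m 0 1 x * weight m 1 0 1 x)"
      using charge_nonneg[of m 0 1 x] charge_eq_0[of 1 x 0 m]
      by (cases "x \<in> {0..<1}") (auto simp: a1_weight_def)
  qed
  also have "\<dots> = ennreal (1 / (64 * real m))"
    using m_pos nn_integral_charge_weight[of 1 1 m 0] by (simp add: power2_eq_square)
  finally show ?thesis .
qed

lemma charge_in_L1w: "charge m 0 1 \<in> L1w a1_weight"
  using L1w_norm_charge by (simp add: L1w_def L1w_norm_def)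

text \<open>The level harm m / 7 is tested: the superlevel set has core mass at least 1/2, and the
  core is dominated by the weight.\<close>

lemma weakL1w_norm_charge:
  assumes L: "7 \<le> (harm m :: real)"
  shows "ennreal (harm m / 14) \<le> weakL1w_norm a1_weight (hilbert (charge m 0 1))"
proof -
  let ?\<alpha> = "harm m / 7 :: real" and ?H = "hilbert (charge m 0 1)"
  have H: "AE x in lborel. ?H x = potential m 0 1 x" and [measurable]: "?H \<in> borel_measurable borel"
    using has_hilbert_AE[OF has_hilbert_charge[of 1 m 0]] by auto
  have "ennreal (1 / 2) \<le> (\<integral>\<^sup>+x. ennreal (core m 1 0 1 x) * indicator {x. ?\<alpha> < potential m 0 1 x} x \<partial>lborel)"
    using core_potential_large[OF L] .
  also have "\<dots> \<le> (\<integral>\<^sup>+x. ennreal (a1_weight x) * indicator {x. ?\<alpha> < \<bar>?H x\<bar>} x \<partial>lborel)"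
  proof (rule nn_integral_mono_AE)
    show "AE x in lborel. ennreal (core m 1 0 1 x) * indicator {x. ?\<alpha> < potential m 0 1 x} x
        \<le> ennreal (a1_weight x) * indicator {x. ?\<alpha> < \<bar>?H x\<bar>} x"
      using H
    proof eventually_elim
      fix x assume "?H x = potential m 0 1 x"
      moreover have "core m 1 0 1 x \<le> a1_weight x"
        using core_le_weight[of 1 m 0 1 x] by (simp add: a1_weight_def add_increasing2)
      ultimately show "ennreal (core m 1 0 1 x) * indicator {x. ?\<alpha> < potential m 0 1 x} x
          \<le> ennreal (a1_weight x) * indicator {x. ?\<alpha> < \<bar>?H x\<bar>} x"
        by (auto simp: indicator_def ennreal_leI)
    qed
  qed
  also have "\<dots> = emeasure (wmeasure a1_weight) {x. ?\<alpha> < \<bar>?H x\<bar>}"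
    unfolding wmeasure_def by (subst emeasure_density) auto
  finally have "ennreal ?\<alpha> * ennreal (1 / 2) \<le> ennreal ?\<alpha> * emeasure (wmeasure a1_weight) {x. ?\<alpha> < \<bar>?H x\<bar>}"
    by (intro mult_left_mono) auto
  also have "\<dots> \<le> weakL1w_norm a1_weight ?H"
    unfolding weakL1w_norm_def by (rule SUP_upper) (use L m_pos in auto)
  also have "ennreal ?\<alpha> * ennreal (1 / 2) = ennreal (harm m / 14)"
    using L by (subst ennreal_mult[symmetric]) auto
  finally show ?thesis .
qed

lemma hilbert_opnorm_a1_weight:
  assumes L: "7 \<le> (harm m :: real)"
  shows "ennreal (4 * real m * harm m) \<le> hilbert_opnorm a1_weight"
proof -
  \<comment> \<open>The quotient is 64/14 * m * harm m, rounded down to 4 * m * harm m.\<close>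
  have "ennreal (4 * real m * harm m) \<le> ennreal (harm m / 14 / (1 / (64 * real m)))"
    using L m_pos by (intro ennreal_leI) (auto simp: field_simps)
  also have "\<dots> = ennreal (harm m / 14) / L1w_norm a1_weight (charge m 0 1)"
    unfolding L1w_norm_charge using L m_pos by (intro divide_ennreal[symmetric]) auto
  also have "\<dots> \<le> weakL1w_norm a1_weight (hilbert (charge m 0 1)) / L1w_norm a1_weight (charge m 0 1)"
    by (intro divide_right_mono_ennreal weakL1w_norm_charge L)
  also have "\<dots> \<le> hilbert_opnorm a1_weight"
    unfolding hilbert_opnorm_def
    using m_pos by (intro SUP_upper) (simp add: charge_in_L1w L1w_norm_charge ennreal_eq_0_iff)
  finally show ?thesis .
qed

lemma phi_H_lower:
  assumes "7 \<le> (harm m :: real)" "513 * real m \<le> t"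
  shows "ennreal (4 * real m * harm m) \<le> phi_H t"
proof -
  have "A1_const a1_weight \<le> ennreal t"
    using A1_const_le ennreal_leI[OF assms(2)] by (rule order_trans)
  then have "hilbert_opnorm a1_weight \<le> phi_H t"
    unfolding phi_H_def by (intro SUP_upper) (simp add: is_weight_a1_weight)
  then show ?thesis
    using hilbert_opnorm_a1_weight[OF assms(1)] by (rule order_trans[rotated])
qed

text \<open>The exact A1 constant is unknown, only that it lies between 1 and 513 * m; monotonicity
  of \<open>\<psi>\<close> moves the estimate to the explicit point 513 * m.\<close>

lemma weak_type_bound_lower:
  assumes L: "7 \<le> (harm m :: real)" and "mono_on {1..} \<psi>" "\<forall>t\<ge>1. 0 \<le> \<psi> t"
    and bound: "weakL1w_norm a1_weight (hilbert (charge m 0 1))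
      \<le> ennreal (\<psi> (enn2real (A1_const a1_weight))) * L1w_norm a1_weight (charge m 0 1)"
  shows "4 * real m * harm m \<le> \<psi> (513 * real m)"
proof -
  let ?A = "enn2real (A1_const a1_weight)"
  have fin: "A1_const a1_weight < \<infinity>"
    using A1_const_le by (rule le_less_trans) simp
  have A: "1 \<le> ?A" "?A \<le> 513 * real m"
    using enn2real_mono[OF A1_const_ge] enn2real_mono[OF A1_const_le] fin by auto
  have "ennreal (harm m / 14) \<le> ennreal (\<psi> ?A) * ennreal (1 / (64 * real m))"
    using order_trans[OF weakL1w_norm_charge[OF L] bound] by (simp only: L1w_norm_charge)
  also have "\<dots> = ennreal (\<psi> ?A * (1 / (64 * real m)))"
    using assms(3) A by (intro ennreal_mult[symmetric]) auto
  finally have "harm m / 14 \<le> \<psi> ?A * (1 / (64 * real m))"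
    using assms(3) A by (subst (asm) ennreal_le_iff) auto
  then have "64 / 14 * real m * harm m \<le> \<psi> ?A"
    using m_pos by (simp add: field_simps)
  also have "\<psi> ?A \<le> \<psi> (513 * real m)"
    using assms(2) A by (auto intro: mono_onD)
  finally have "64 / 14 * (real m * harm m) \<le> \<psi> (513 * real m)"
    by (simp only: mult.assoc)
  moreover have "0 \<le> real m * harm m"
    using L by simp
  ultimately show ?thesis
    by linarith
qed

end

lemma phi_H_ge_half:
  assumes "1 \<le> t"
  shows "ennreal (1 / 2) \<le> phi_H t"
proof -
  define w :: "real \<Rightarrow> real" where "w = (\<lambda>_. 1)"
  define f :: "real \<Rightarrow> real" where "f = indicator {0..<1}"
  have w: "is_weight w"
    unfolding is_weight_def w_def set_integrable_def by (auto intro!: integrable_real_indicator emeasure_lborel_Icc_eq[THEN ord_eq_less_trans])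
  have "maximal_fn w x \<le> 1" for x
    unfolding maximal_fn_def
    by (rule SUP_least) (auto simp: w_def divide_ennreal)
  then have "A1_const w \<le> 1"
    unfolding A1_const_def by (intro Inf_lower) (simp add: w_def divide_ennreal_def)
  also have "1 \<le> ennreal t"
    using assms by simp
  finally have A1: "A1_const w \<le> ennreal t" .
  have norm: "L1w_norm w f = 1"
    unfolding L1w_norm_def w_def f_def by (simp add: ennreal_indicator)
  then have f: "f \<in> L1w w"
    unfolding L1w_def L1w_norm_def by (auto simp: f_def)
  have H: "AE x in lborel. hilbert f x = ln (\<bar>x - 0\<bar>) - ln (\<bar>x - 1\<bar>)"
    and [measurable]: "hilbert f \<in> borel_measurable borel"
    unfolding f_def using has_hilbert_AE[OF has_hilbert_interval[of 0 1]] by auto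
  have "1 = emeasure lborel {1<..<2::real}"
    by simp
  also have "\<dots> \<le> emeasure lborel {x. 1 / 2 < \<bar>hilbert f x\<bar>}"
  proof (rule emeasure_mono_AE)
    show "AE x in lborel. x \<in> {1<..<2} \<longrightarrow> x \<in> {x. 1 / 2 < \<bar>hilbert f x\<bar>}"
      using H
    proof eventually_elim
      case (elim x)
      show ?case
      proof
        assume x: "x \<in> {1<..<2}"
        have "ln ((x - 1) / x) \<le> (x - 1) / x - 1"
          using x by (intro ln_le_minus_one) auto
        moreover have "(x - 1) / x - 1 < - (1 / 2)"
          using x by (simp add: field_simps)
        moreover have "hilbert f x = - ln ((x - 1) / x)"
          using x elim by (simp add: ln_div)
        ultimately show "x \<in> {x. 1 / 2 < \<bar>hilbert f x\<bar>}"
          by simp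
      qed
    qed
  qed measurable
  also have "\<dots> = emeasure (wmeasure w) {x. 1 / 2 < \<bar>hilbert f x\<bar>}"
    unfolding wmeasure_def w_def by (subst emeasure_density) auto
  finally have "ennreal (1 / 2) * 1 \<le> ennreal (1 / 2) * emeasure (wmeasure w) {x. 1 / 2 < \<bar>hilbert f x\<bar>}"
    by (intro mult_left_mono) auto
  also have "\<dots> \<le> weakL1w_norm w (hilbert f)"
    unfolding weakL1w_norm_def by (rule SUP_upper) auto
  also have "\<dots> = weakL1w_norm w (hilbert f) / L1w_norm w f"
    by (simp add: norm divide_ennreal_def)
  also have "\<dots> \<le> hilbert_opnorm w"
    unfolding hilbert_opnorm_def by (rule SUP_upper) (use f norm in auto)
  also have "\<dots> \<le> phi_H t"
    unfolding phi_H_def by (rule SUP_upper) (use w A1 in auto)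
  finally show ?thesis
    by simp
qed

section \<open>Choice of parameters and conclusion\<close>

theorem theorem1:
  shows "(\<exists>c>0. \<forall>t\<ge>1. ennreal (c * t * ln (exp 1 + t)) \<le> phi_H t)
    \<and> (\<forall>\<psi> :: real \<Rightarrow> real.
          (\<forall>t\<ge>1. 0 \<le> \<psi> t) \<and> mono_on {1..} \<psi> \<and>
          ((\<lambda>t. \<psi> t / (t * ln (exp 1 + t))) \<longlongrightarrow> 0) at_top
        \<longrightarrow> \<not> (\<forall>w. is_weight w \<and> A1_const w < \<infinity> \<longrightarrow>
                 (\<forall>f \<in> L1w w. weakL1w_norm w (hilbert f)
                      \<le> ennreal (\<psi> (enn2real (A1_const w))) * L1w_norm w f)))"
proof (intro conjI allI impI notI)
  \<comment> \<open>The right side grows like (4 / 513) * t * ln t, and 4/513 exceeds 1/1000. The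
    term t / 513 - 1 allows for rounding down to an integer \<open>m\<close>; the later condition
    1026 \<le> t makes that \<open>m\<close> positive.\<close>
  have "\<forall>\<^sub>F t::real in at_top. t * ln (exp 1 + t) / 1000 \<le> 4 * (t / 513 - 1) * ln (t / 513)"
    by real_asymp
  moreover have "\<forall>\<^sub>F t::real in at_top. 7 \<le> ln (t / 513)"
    by real_asymp
  ultimately have "\<forall>\<^sub>F t::real in at_top. t * ln (exp 1 + t) / 1000 \<le> 4 * (t / 513 - 1) * ln (t / 513) \<and>
      7 \<le> ln (t / 513) \<and> 1026 \<le> t"
    by (intro eventually_conj eventually_ge_at_top)
  then obtain T :: real where T: "\<And>t. T \<le> t \<Longrightarrow>
      t * ln (exp 1 + t) / 1000 \<le> 4 * (t / 513 - 1) * ln (t / 513) \<and> 7 \<le> ln (t / 513) \<and> 1026 \<le> t"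
    unfolding eventually_at_top_linorder by blast
  have T1: "1 \<le> T"
    using T[of T] by simp
  define K where "K = T * ln (exp 1 + T)"
  have ln1: "1 \<le> ln (exp 1 + t)" if "0 \<le> t" for t :: real
    using that by (subst ln_ge_iff) (auto intro: add_pos_nonneg)
  have K: "0 < K"
    unfolding K_def using T1 ln1[of T] by (intro mult_pos_pos) auto
  \<comment> \<open>The first entry serves t \<ge> T. The second keeps c * t * ln (e + t) below 1/2
    for t < T, since \<open>K\<close> bounds t * ln (e + t) there by monotonicity.\<close>
  define c where "c = min (1 / 1000) (1 / (2 * K))"
  have "0 < c"
    using K by (simp add: c_def)
  moreover have "ennreal (c * t * ln (exp 1 + t)) \<le> phi_H t" if t: "1 \<le> t" for t
  proof (cases "T \<le> t")
    case True
    \<comment> \<open>The largest \<open>m\<close> whose A1 bound 513 * m does not exceed t.\<close>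
    define m where "m = nat \<lfloor>t / 513\<rfloor>"
    have m: "real m \<le> t / 513" "t / 513 - 1 \<le> real m"
      using t unfolding m_def by linarith+
    have "0 < m"
      using m T[OF True] by (intro gr0I) auto
    then interpret branching m
      by unfold_locales
    have "ln (t / 513) \<le> ln (real m + 1)"
      using m t by (subst ln_le_cancel_iff) auto
    also have "\<dots> \<le> harm m"
      by (rule ln_le_harm)
    finally have L: "ln (t / 513) \<le> harm m" .
    have "c * t * ln (exp 1 + t) \<le> 1 / 1000 * t * ln (exp 1 + t)"
      using t ln1[of t] by (intro mult_right_mono) (auto simp: c_def)
    also have "\<dots> \<le> 4 * (t / 513 - 1) * ln (t / 513)"
      using T[OF True] by simp
    also have "\<dots> \<le> 4 * real m * harm m"
      using T[OF True] m L by (intro mult_mono) auto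
    finally have "ennreal (c * t * ln (exp 1 + t)) \<le> ennreal (4 * real m * harm m)"
      by (rule ennreal_leI)
    also have "\<dots> \<le> phi_H t"
      using T[OF True] m L by (intro phi_H_lower) auto
    finally show ?thesis .
  next
    case False
    have "c * t * ln (exp 1 + t) = c * (t * ln (exp 1 + t))"
      by simp
    also have "\<dots> \<le> 1 / (2 * K) * K"
    proof (rule mult_mono)
      show "t * ln (exp 1 + t) \<le> K"
        unfolding K_def using False t ln1[of t] by (intro mult_mono) (auto simp: add_pos_pos intro: add_increasing)
    qed (use K t ln1[of t] in \<open>auto simp: c_def\<close>)
    also have "\<dots> = 1 / 2"
      using K by simp
    finally show ?thesis
      using phi_H_ge_half[OF t] order_trans ennreal_leI by blast
  qed
  ultimately show "\<exists>c>0. \<forall>t\<ge>1. ennreal (c * t * ln (exp 1 + t)) \<le> phi_H t"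
    by blast
next
  fix \<psi> :: "real \<Rightarrow> real"
  assume \<psi>: "(\<forall>t\<ge>1. 0 \<le> \<psi> t) \<and> mono_on {1..} \<psi> \<and>
      ((\<lambda>t. \<psi> t / (t * ln (exp 1 + t))) \<longlongrightarrow> 0) at_top"
    and bound: "\<forall>w. is_weight w \<and> A1_const w < \<infinity> \<longrightarrow>
      (\<forall>f \<in> L1w w. weakL1w_norm w (hilbert f) \<le> ennreal (\<psi> (enn2real (A1_const w))) * L1w_norm w f)"
  have "\<forall>\<^sub>F t in at_top. \<psi> t / (t * ln (exp 1 + t)) < 1 / 1000"
    using \<psi> by (intro order_tendstoD) auto
  moreover have "filterlim (\<lambda>m. 513 * real m) at_top sequentially"
    by real_asymp
  ultimately have "\<forall>\<^sub>F m in sequentially.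
      \<psi> (513 * real m) / (513 * real m * ln (exp 1 + 513 * real m)) < 1 / 1000"
    using eventually_compose_filterlim by fastforce
  \<comment> \<open>The leading coefficients are 0.513 and 4, so the assumed smallness of
    \<open>\<psi>\<close> at 513 * m contradicts \<open>weak_type_bound_lower\<close> for large
    \<open>m\<close>.\<close>
  moreover have "\<forall>\<^sub>F m in sequentially. 1 / 1000 * (513 * real m * ln (exp 1 + 513 * real m))
      < 4 * real m * ln (real m + 1)"
    by real_asymp
  moreover have "\<forall>\<^sub>F m in sequentially. 7 \<le> ln (real m + 1)"
    by real_asymp
  ultimately have "\<forall>\<^sub>F m in sequentially. False"
    using eventually_gt_at_top[of 0]
  proof eventually_elim
    case (elim m)
    interpret branching m
      using elim by unfold_locales
    have L: "ln (real m + 1) \<le> harm m"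
      by (rule ln_le_harm)
    have "4 * real m * harm m \<le> \<psi> (513 * real m)"
    proof (rule weak_type_bound_lower)
      have "A1_const a1_weight < \<infinity>"
        using A1_const_le by (rule le_less_trans) simp
      then show "weakL1w_norm a1_weight (hilbert (charge m 0 1))
          \<le> ennreal (\<psi> (enn2real (A1_const a1_weight))) * L1w_norm a1_weight (charge m 0 1)"
        using bound is_weight_a1_weight charge_in_L1w by blast
    qed (use L elim \<psi> in auto)
    moreover have "\<psi> (513 * real m) < 1 / 1000 * (513 * real m * ln (exp 1 + 513 * real m))"
    proof -
      have "1 < exp 1 + 513 * real m"
        using exp_gt_one[of "1::real"] of_nat_0_le_iff[of m, where 'a = real] by linarith
      then have "0 < 513 * real m * ln (exp 1 + 513 * real m)"
        using elim by (intro mult_pos_pos) auto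
      then show ?thesis
        using elim(1) by (simp only: pos_divide_less_eq)
    qed
    moreover have "4 * real m * ln (real m + 1) \<le> 4 * real m * harm m"
      using L by (intro mult_left_mono) auto
    ultimately show ?case
      using elim(2) by linarith
  qed
  then show False
    by simp
qed

end
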